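(* Let $X_0,X_1,\dots,X_n$ be vector fields on a bounded domain $\Omega\subset\mathbb{R}^p$, with $X_1,\dots,X_n$ having $C^{r-1,\alpha}(\Omega)$ coefficients and $X_0$ having $C^{r-2,\alpha}(\Omega)$ coefficients ($r\ge2$ integer, $\alpha\in(0,1]$), satisfying Hörmander's condition of step $r$ in $\Omega$ and free up to weight $r$ in $\Omega$. Let $\Theta_{\overline x}(\cdot)$ be the map given by regularized canonical coordinates centered at $\overline x$ (defined in the context). Then for any fixed $x$, the map $\overline x\mapsto\Theta_{\overline x}(x)$ (defined for $\overline x$ near $x$) is $C^\alpha$. Moreover, each entry of the Jacobian matrix $$\frac{\partial\Theta_{\overline x}(x)}{\partial x}$$ still depends on $\overline x$ in a $C^\alpha$ way.
   Context: Weights and commutators: $X_0$ has weight $p_0=2$, $X_i$ has weight $p_i=1$ for $i\ge1$. For $I=(i_1,\dots,i_k)$, $i_j\in\{0,\dots,n\}$, $|I|=\sum_j p_{i_j}$ and $X_{[I]}=[X_{i_1},[X_{i_2},\dots[X_{i_{k-1}},X_{i_k}]\dots]]$, $X_{[(i)]}=X_i$. Hörmander's condition of step $r$ in $\Omega$: $\{(X_{[I]})_x\}_{|I|\le r}$ spans $\mathbb{R}^p$ for every $x\in\Omega$. In noncommuting indeterminates $\xi_0,\dots,\xi_n$ write $\xi_{[I]}=[\xi_{i_1},[\dots,\xi_{i_k}]\dots]=\sum_JA_{IJ}\xi_J$. The fields are free up to weight $r$ in $\Omega$ if at each $x\in\Omega$: $\sum_{|I|\le r}a_I(X_{[I]})_x=0$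 (real constants $a_I$) implies $\sum_{|I|\le r} a_IA_{IJ}=0$ for all $J$. A set $B$ of $p$ multiindices of weight $\le r$ is fixed so that $\{(X_{[I]})_x\}_{I\in B}$ is a basis of $\mathbb{R}^p$ at every $x\in\Omega$. Smooth approximating fields: if $X_i=\sum_j b_{ij}(x)\partial_{x_j}$, then for $\overline x\in\Omega$, $S_i^{\overline x}=\sum_j p_{ij}(x)\partial_{x_j}$, where $p_{ij}$ is the Taylor polynomial of $b_{ij}$ centered at $\overline x$ of order $r-p_i$. These are smooth on $\mathbb{R}^p$ and $(S^{\overline x}_{[I]})_{\overline x}=(X_{[I]})_{\overline x}$ for $|I|\le r$. The map $\Theta$: $\exp(Z)(\overline x)$ is the time-1 value of the solution of $\phi'=Z_\phi$, $\phi(0)=\overline x$. For $u=(u_I)_{I\in B}\in\mathbb{R}^p$ near $0$, put $E(u,\overline x)=\exp(\sum_{I\in B}u_IS^{\overline x}_{[I]})(\overline x)$. For fixed $\overline x$, $u\mapsto E(u,\overline x)$ is a smooth diffeomorphism from a neighborhood of $0$ onto a neighborhood of $\overline x$, and $u=\Theta_{\overline x}(x)$ denotes its inverse. "$C^\alpha$" means (locally) Hölder continuous of exponent $\alpha$. *)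

theory Defs
  imports "HOL-Analysis.Analysis"
begin

section \<open>Hoelder classes and Taylor polynomials\<close>

definition holder_on :: "real \<Rightarrow> 'a::metric_space set \<Rightarrow> ('a \<Rightarrow> 'b::metric_space) \<Rightarrow> bool" where
  "holder_on \<alpha> S f \<longleftrightarrow> (\<exists>C. \<forall>x\<in>S. \<forall>y\<in>S. dist (f x) (f y) \<le> C * dist x y powr \<alpha>)"

definition locally_holder_on :: "real \<Rightarrow> 'a::metric_space set \<Rightarrow> ('a \<Rightarrow> 'b::metric_space) \<Rightarrow> bool" where
  "locally_holder_on \<alpha> S f \<longleftrightarrow> (\<forall>x\<in>S. \<exists>\<epsilon>>0. holder_on \<alpha> (S \<inter> ball x \<epsilon>) f)"

definition partial_deriv :: "'p \<Rightarrow> (real^'p \<Rightarrow> 'b::real_normed_vector) \<Rightarrow> real^'p \<Rightarrow> 'b" where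
  "partial_deriv j f x = frechet_derivative f (at x) (axis j 1)"

fun iter_partial :: "'p list \<Rightarrow> (real^'p \<Rightarrow> real) \<Rightarrow> real^'p \<Rightarrow> real" where
  "iter_partial [] f = f"
| "iter_partial (j # js) f = partial_deriv j (iter_partial js f)"

text \<open>
  The class of functions of type \<open>C\<^sup>k\<^sup>,\<^sup>\<alpha>\<close>, in the local sense, on an open set. Lower order derivatives are
  differentiable, hence continuous (and locally Lipschitz, as the derivatives of order \<open>k\<close> are
  continuous), so that a Hoelder condition is only needed at order \<open>k\<close>.
\<close>

definition C_holder_on :: "nat \<Rightarrow> real \<Rightarrow> (real^'p) set \<Rightarrow> (real^'p \<Rightarrow> real) \<Rightarrow> bool" where
  "C_holder_on k \<alpha> S f \<longleftrightarrow>
     (\<forall>js. length js < k \<longrightarrow> (\<forall>x\<in>S. iter_partial js f differentiable (at x))) \<and>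
     (\<forall>js. length js = k \<longrightarrow> locally_holder_on \<alpha> S (iter_partial js f))"

text \<open>
  The Taylor polynomial of order \<open>m\<close> centered at \<open>c\<close>. The sum runs over ordered tuples of
  coordinate directions, whence the factor \<open>1/k!\<close>: a multiindex \<open>\<beta>\<close> of order \<open>k\<close> arises from
  \<open>k!/\<beta>!\<close> tuples.
\<close>

definition taylor_poly :: "nat \<Rightarrow> (real^'p \<Rightarrow> real) \<Rightarrow> real^'p \<Rightarrow> real^'p \<Rightarrow> real" where
  "taylor_poly m f c x =
     (\<Sum>k\<le>m. (\<Sum>js | length js = k. iter_partial js f c * prod_list (map (\<lambda>j. (x - c) $ j) js)) / fact k)"

section \<open>Commutators of vector fields\<close>

text \<open>A vector field \<open>\<Sum>\<^sub>j b\<^sub>j \<partial>\<^sub>j\<close> is represented by the map \<open>b\<close>.\<close>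

type_synonym 'p vfield = "real^'p \<Rightarrow> real^'p"

definition lie_bracket :: "'p::finite vfield \<Rightarrow> 'p::finite vfield \<Rightarrow> 'p::finite vfield" where
  "lie_bracket X Y x = frechet_derivative Y (at x) (X x) - frechet_derivative X (at x) (Y x)"

fun commutator :: "(nat \<Rightarrow> 'p::finite vfield) \<Rightarrow> nat list \<Rightarrow> 'p::finite vfield" where
  "commutator X [] = (\<lambda>x. 0)"
| "commutator X [i] = X i"
| "commutator X (i # j # I) = lie_bracket (X i) (commutator X (j # I))"

definition field_weight :: "nat \<Rightarrow> nat" where
  "field_weight i = (if i = 0 then 2 else 1)"

definition weight :: "nat list \<Rightarrow> nat" where
  "weight I = sum_list (map field_weight I)"

definition multiindices :: "nat \<Rightarrow> nat \<Rightarrow> nat list set" where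
  "multiindices n r = {I. I \<noteq> [] \<and> set I \<subseteq> {0..n} \<and> weight I \<le> r}"

definition hormander_condition :: "nat \<Rightarrow> nat \<Rightarrow> (nat \<Rightarrow> 'p::finite vfield) \<Rightarrow> (real^'p) set \<Rightarrow> bool" where
  "hormander_condition n r X \<Omega> \<longleftrightarrow>
     (\<forall>x\<in>\<Omega>. span ((\<lambda>I. commutator X I x) ` multiindices n r) = UNIV)"

section \<open>Freeness\<close>

text \<open>
  An element of the free associative algebra on \<open>\<xi>\<^sub>0, \<xi>\<^sub>1, \<dots>\<close> is represented by the family of its
  coefficients with respect to the words \<open>\<xi>\<^sub>J\<close>; \<open>nc_commutator I J\<close> is the coefficient \<open>A\<^sub>I\<^sub>J\<close>.
\<close>

type_synonym nc_poly = "nat list \<Rightarrow> real"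

definition nc_var :: "nat \<Rightarrow> nc_poly" where
  "nc_var i J = (if J = [i] then 1 else 0)"

definition nc_mult :: "nc_poly \<Rightarrow> nc_poly \<Rightarrow> nc_poly" where
  "nc_mult f g J = (\<Sum>k\<le>length J. f (take k J) * g (drop k J))"

fun nc_commutator :: "nat list \<Rightarrow> nc_poly" where
  "nc_commutator [] = (\<lambda>J. 0)"
| "nc_commutator [i] = nc_var i"
| "nc_commutator (i # j # I) = (\<lambda>J. nc_mult (nc_var i) (nc_commutator (j # I)) J
                                   - nc_mult (nc_commutator (j # I)) (nc_var i) J)"

definition free_up_to_weight :: "nat \<Rightarrow> nat \<Rightarrow> (nat \<Rightarrow> 'p::finite vfield) \<Rightarrow> (real^'p) set \<Rightarrow> bool" where
  "free_up_to_weight n r X \<Omega> \<longleftrightarrow>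
     (\<forall>x\<in>\<Omega>. \<forall>a :: nat list \<Rightarrow> real.
        (\<Sum>I\<in>multiindices n r. a I *\<^sub>R commutator X I x) = 0 \<longrightarrow>
        (\<forall>J. (\<Sum>I\<in>multiindices n r. a I * nc_commutator I J) = 0))"

text \<open>
  The set \<open>B\<close> of \<open>p\<close> multiindices is given by an injective enumeration over the index type of
  \<open>\<real>\<^sup>p\<close>, which identifies \<open>(u\<^sub>I)\<^sub>I\<^sub>\<in>\<^sub>B\<close> with a vector \<open>u\<close>, with \<open>u\<^sub>I = u $ k\<close> for \<open>I = B k\<close>.
\<close>

definition commutator_basis ::
    "nat \<Rightarrow> nat \<Rightarrow> (nat \<Rightarrow> 'p::finite vfield) \<Rightarrow> (real^'p) set \<Rightarrow> ('p \<Rightarrow> nat list) \<Rightarrow> bool" where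
  "commutator_basis n r X \<Omega> B \<longleftrightarrow>
     inj B \<and> range B \<subseteq> multiindices n r \<and>
     (\<forall>x\<in>\<Omega>. inj (\<lambda>k. commutator X (B k) x) \<and>
            independent (range (\<lambda>k. commutator X (B k) x)) \<and>
            span (range (\<lambda>k. commutator X (B k) x)) = UNIV)"

section \<open>Regularized canonical coordinates\<close>

definition approx_field :: "nat \<Rightarrow> (nat \<Rightarrow> 'p::finite vfield) \<Rightarrow> real^'p \<Rightarrow> nat \<Rightarrow> 'p::finite vfield" where
  "approx_field r X xbar i x = (\<chi> j. taylor_poly (r - field_weight i) (\<lambda>y. X i y $ j) xbar x)"

definition integral_curve :: "'p::finite vfield \<Rightarrow> real^'p \<Rightarrow> (real \<Rightarrow> real^'p) \<Rightarrow> bool" where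
  "integral_curve Z x \<phi> \<longleftrightarrow>
     \<phi> 0 = x \<and> (\<forall>t\<in>{0..1}. (\<phi> has_vector_derivative Z (\<phi> t)) (at t within {0..1}))"

definition exp_field :: "'p::finite vfield \<Rightarrow> real^'p \<Rightarrow> real^'p" where
  "exp_field Z x = (THE y. \<exists>\<phi>. integral_curve Z x \<phi> \<and> \<phi> 1 = y)"

definition canonical_field ::
    "nat \<Rightarrow> (nat \<Rightarrow> 'p::finite vfield) \<Rightarrow> ('p \<Rightarrow> nat list) \<Rightarrow> real^'p \<Rightarrow> real^'p \<Rightarrow> 'p::finite vfield" where
  "canonical_field r X B u xbar x =
     (\<Sum>k\<in>UNIV. u $ k *\<^sub>R commutator (approx_field r X xbar) (B k) x)"

definition canonical_E ::
    "nat \<Rightarrow> (nat \<Rightarrow> 'p::finite vfield) \<Rightarrow> ('p \<Rightarrow> nat list) \<Rightarrow> real^'p \<Rightarrow> real^'p \<Rightarrow> real^'p" where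
  "canonical_E r X B u xbar = exp_field (canonical_field r X B u xbar) xbar"

text \<open>The inverse of \<open>u \<mapsto> E(u, xbar)\<close> restricted to the ball of radius \<open>\<rho>\<close> about \<open>0\<close>.\<close>

definition Theta ::
    "nat \<Rightarrow> (nat \<Rightarrow> 'p::finite vfield) \<Rightarrow> ('p \<Rightarrow> nat list) \<Rightarrow> real \<Rightarrow> real^'p \<Rightarrow> real^'p \<Rightarrow> real^'p" where
  "Theta r X B \<rho> xbar = inv_into (ball 0 \<rho>) (\<lambda>u. canonical_E r X B u xbar)"

definition C1_on :: "(real^'p) set \<Rightarrow> (real^'p \<Rightarrow> real^'p) \<Rightarrow> bool" where
  "C1_on S f \<longleftrightarrow> (\<forall>x\<in>S. f differentiable (at x)) \<and> (\<forall>j. continuous_on S (partial_deriv j f))"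

definition diffeomorphism_onto_image :: "(real^'p) set \<Rightarrow> (real^'p \<Rightarrow> real^'p) \<Rightarrow> bool" where
  "diffeomorphism_onto_image U f \<longleftrightarrow>
     open U \<and> open (f ` U) \<and> inj_on f U \<and> C1_on U f \<and> C1_on (f ` U) (inv_into U f)"

text \<open>
  The coordinates centered at \<open>xbar\<close> are well defined on the ball of radius \<open>\<rho>\<close>: all the
  exponentials involved exist, and \<open>u \<mapsto> E(u, xbar)\<close> is a diffeomorphism onto an open set. That set
  contains \<open>xbar = E(0, xbar)\<close>.
\<close>

definition canonical_coordinates_on ::
    "nat \<Rightarrow> (nat \<Rightarrow> 'p::finite vfield) \<Rightarrow> ('p \<Rightarrow> nat list) \<Rightarrow> real \<Rightarrow> real^'p \<Rightarrow> bool" where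
  "canonical_coordinates_on r X B \<rho> xbar \<longleftrightarrow>
     (\<forall>u\<in>ball 0 \<rho>. \<exists>\<phi>. integral_curve (canonical_field r X B u xbar) xbar \<phi>) \<and>
     diffeomorphism_onto_image (ball 0 \<rho>) (\<lambda>u. canonical_E r X B u xbar)"

end

theory Submission
  imports Defs
begin

text \<open>
  At \<open>xbar\<close> the approximating fields have the same jets as the original ones, so their commutators of
  weight at most \<open>r\<close> agree there with the original ones; in particular the derivative of
  \<open>u \<mapsto> E(u, xbar)\<close> at \<open>u = 0\<close> is invertible at \<open>xbar = x\<close>. In the space variable the approximating
  fields and their commutators are polynomials, with coefficients that are Hoelder continuous in
  \<open>xbar\<close>. For small \<open>u\<close> the equation \<open>\<phi>' = \<Sum>\<^sub>k u\<^sub>k S\<^sub>k(\<phi>)\<close> has Lipschitz constant at most \<open>1/2\<close>, so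
  contraction estimates on the time interval \<open>[0,1]\<close> replace Gronwall's inequality: both \<open>E(u, xbar)\<close>
  and its derivative in \<open>u\<close>, the solution of the variational equation, are Lipschitz in \<open>u\<close> and
  Hoelder in \<open>xbar\<close>. Inverting the map \<open>u \<mapsto> E(u, xbar)\<close>, which is uniformly close to a linear
  isomorphism, preserves these moduli of continuity.
\<close>

section \<open>Ordinary differential equations with small Lipschitz constant\<close>

text \<open>The fields \<open>S\<close> are only Hoelder continuous in the centre, so no implicit
  function theorem applies in that variable: every modulus in the centre comes from comparing two
  problems with different centres. The centre enters twice, as a parameter of the field and as the
  initial point. The second role contributes a term \<open>norm (c - c')\<close>, which is absorbed
  into its power \<open>\<alpha>\<close> because the centres range over a set of diameter at most 1.
  The Jacobian of \<open>Theta\<close> is the inverse of the \<open>u\<close>-derivative of the flow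
  taken at the point \<open>Theta\<close> of \<open>x\<close>, which itself moves with the centre.
  Hence the derivative has to be controlled jointly in \<open>u\<close> and the centre, and the
  space derivative of the fields must be Lipschitz in space. Agreement of jets is needed at the
  single centre \<open>x\<close> only; the joint estimate carries invertibility over to nearby
  centres. As \<open>Theta\<close> inverts the flow on a ball of prescribed radius, that ball must
  reach \<open>x\<close> from every admissible centre. The range of centres is therefore chosen
  after the radius.\<close>

lemma norm_diff_le_interval:
  fixes d :: "real \<Rightarrow> 'a::real_normed_vector"
  assumes "\<And>t. t \<in> {0..1} \<Longrightarrow> (d has_vector_derivative g t) (at t within {0..1})"
    and "\<And>t. t \<in> {0..1} \<Longrightarrow> norm (g t) \<le> K" and "t \<in> {0..1}"
  shows "norm (d t - d 0) \<le> K * t"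
proof -
  have "norm (d t - d 0) \<le> K * norm (t - 0)"
    by (rule differentiable_bound[where S="{0..1}" and f'="\<lambda>x h. h *\<^sub>R g x"])
      (use assms in \<open>auto simp: has_vector_derivative_def mult.commute[of K] intro!: onorm_le mult_left_mono\<close>)
  then show ?thesis using assms(3) by simp
qed

text \<open>At a point where \<open>norm (d t)\<close> is maximal on the unit interval, the mean
  value inequality bounds the maximum by \<open>norm (d 0) + e\<close> plus half of the maximum
  itself; the half is absorbed on the left.\<close>

lemma sup_le_of_deriv_half:
  fixes d :: "real \<Rightarrow> 'a::real_normed_vector"
  assumes deriv: "\<And>t. t \<in> {0..1} \<Longrightarrow> (d has_vector_derivative g t) (at t within {0..1})"
    and half: "\<And>t. t \<in> {0..1} \<Longrightarrow> norm (g t) \<le> norm (d t) / 2 + e"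
    and t: "t \<in> {0..1}"
  shows "norm (d t) \<le> 2 * (norm (d 0) + e)"
proof -
  have "continuous_on {0..1} d"
    using deriv by (meson continuous_on_eq_continuous_within has_vector_derivative_continuous)
  then have "continuous_on {0..1} (\<lambda>t. norm (d t))"
    by (intro continuous_intros)
  then obtain s where s: "s \<in> {0..1}" "\<And>t. t \<in> {0..1} \<Longrightarrow> norm (d t) \<le> norm (d s)"
    using continuous_attains_sup[of "{0..1::real}" "\<lambda>t. norm (d t)"] by auto
  define K where "K = norm (d s) / 2 + e"
  have K: "norm (g t) \<le> K" if "t \<in> {0..1}" for t
    using half[OF that] s(2)[OF that] by (simp add: K_def)
  have "0 \<le> K" using order_trans[OF norm_ge_zero K[of 0]] by simp
  have "norm (d s - d 0) \<le> K * s"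
    by (rule norm_diff_le_interval[OF deriv K]) (use s in auto)
  also have "\<dots> \<le> K" using \<open>0 \<le> K\<close> s(1) by (simp add: mult_left_le)
  finally have "norm (d s) \<le> norm (d 0) + K"
    using norm_triangle_ineq2[of "d s" "d 0"] by linarith
  then show ?thesis using s(2)[OF t] by (simp add: K_def)
qed

text \<open>Over a time interval of length one the Picard operator is a contraction as soon as the
  right-hand side has Lipschitz constant \<open>1/2\<close>.\<close>

lemma picard_half_lipschitz:
  fixes G :: "real \<Rightarrow> 'a::banach \<Rightarrow> 'a"
  assumes cont: "\<And>\<psi>. continuous_on {0..1} \<psi> \<Longrightarrow> continuous_on {0..1} (\<lambda>t. G t (\<psi> t))"
    and lip: "\<And>t y z. t \<in> {0..1} \<Longrightarrow> norm (G t y - G t z) \<le> norm (y - z) / 2"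
  obtains \<phi> where "\<phi> 0 = c"
    "\<And>t. t \<in> {0..1} \<Longrightarrow> (\<phi> has_vector_derivative G t (\<phi> t)) (at t within {0..1})"
proof -
  \<comment> \<open>Clamping time to the unit interval makes the Picard iterates bounded and
    continuous on the whole line, so that the fixed point can be taken in the complete space of
    bounded continuous functions.\<close>
  define cl :: "real \<Rightarrow> real" where "cl t = max 0 (min 1 t)" for t
  have cl: "cl t \<in> {0..1}" for t by (auto simp: cl_def)
  have cl_id: "t \<in> {0..1} \<Longrightarrow> cl t = t" for t by (auto simp: cl_def)
  have cl_cont: "continuous_on UNIV cl" unfolding cl_def by (intro continuous_intros)
  define I where "I \<psi> t = c + integral {0..t} (\<lambda>s. G s (\<psi> s))" for \<psi> t
  have I_deriv: "(I \<psi> has_vector_derivative G t (\<psi> t)) (at t within {0..1})"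
    if "continuous_on {0..1} \<psi>" "t \<in> {0..1}" for \<psi> t
  proof -
    have "((\<lambda>u. integral {0..u} (\<lambda>s. G s (\<psi> s))) has_vector_derivative G t (\<psi> t)) (at t within {0..1})"
      by (rule integral_has_vector_derivative[OF cont[OF that(1)] that(2)])
    then show ?thesis
      unfolding I_def using has_vector_derivative_add[OF has_vector_derivative_const[of c]] by fastforce
  qed
  define T :: "(real \<Rightarrow>\<^sub>C 'a) \<Rightarrow> (real \<Rightarrow>\<^sub>C 'a)" where "T \<psi> = Bcontfun (\<lambda>t. I \<psi> (cl t))" for \<psi>
  have I_cont: "continuous_on {0..1} (I \<psi>)" if "continuous_on {0..1} \<psi>" for \<psi>
    using I_deriv[OF that] by (meson continuous_on_eq_continuous_within has_vector_derivative_continuous)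
  have T_app: "T \<psi> t = I \<psi> (cl t)" for \<psi> t
  proof -
    have "continuous_on {0..1} (I \<psi>)" by (rule I_cont) simp
    moreover have "continuous_on UNIV (\<lambda>t. I \<psi> (cl t))"
      by (rule continuous_on_compose2[OF calculation cl_cont]) (use cl in auto)
    moreover have "bounded (I \<psi> ` {0..1})"
      using calculation by (intro compact_imp_bounded compact_continuous_image) auto
    then have "bounded (range (\<lambda>t. I \<psi> (cl t)))"
      by (rule bounded_subset) (use cl in auto)
    ultimately show ?thesis unfolding T_def by (simp add: Bcontfun_inverse bcontfun_def)
  qed
  have "dist (T \<phi>) (T \<psi>) \<le> (1/2) * dist \<phi> \<psi>" for \<phi> \<psi>
  proof (rule dist_bound)
    fix t
    have *: "norm ((I \<phi> (cl t) - I \<psi> (cl t)) - (I \<phi> 0 - I \<psi> 0)) \<le> (dist \<phi> \<psi> / 2) * cl t"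
    proof (rule norm_diff_le_interval[OF _ _ cl])
      fix s :: real assume s: "s \<in> {0..1}"
      show "((\<lambda>s. I \<phi> s - I \<psi> s) has_vector_derivative (G s (\<phi> s) - G s (\<psi> s))) (at s within {0..1})"
        by (intro has_vector_derivative_diff I_deriv s continuous_on_apply_bcontfun)
      show "norm (G s (\<phi> s) - G s (\<psi> s)) \<le> dist \<phi> \<psi> / 2"
        using lip[OF s, of "\<phi> s" "\<psi> s"] dist_bounded[of \<phi> s \<psi>] by (simp add: dist_norm)
    qed
    also have "\<dots> \<le> dist \<phi> \<psi> / 2" using cl[of t] by (intro mult_left_le) auto
    finally show "dist (T \<phi> t) (T \<psi> t) \<le> (1/2) * dist \<phi> \<psi>"
      by (simp add: T_app dist_norm I_def)
  qed
  then obtain \<phi> where \<phi>: "T \<phi> = \<phi>"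
    using banach_fix_type[of "1/2" T] by auto
  have eq: "\<phi> t = I \<phi> t" if "t \<in> {0..1}" for t
    using T_app[of \<phi> t] \<phi> cl_id[OF that] by simp
  show thesis
  proof
    show "\<phi> 0 = c" using eq[of 0] by (simp add: I_def)
    show "(\<phi> has_vector_derivative G t (\<phi> t)) (at t within {0..1})" if "t \<in> {0..1}" for t
      by (rule has_vector_derivative_transform[OF that _ I_deriv])
        (use eq that in auto)
  qed
qed

section \<open>Flows depending on a Hoelder parameter\<close>

text \<open>The field is linear in the coordinates \<open>u\<close>, so \<open>F c y\<close> is the
  linear map from \<open>u\<close> to the value at \<open>y\<close> of the field with centre
  \<open>c\<close>. \<open>G c y u\<close> is its derivative in \<open>y\<close>. One constant
  \<open>M\<close> serves for all bounds: Lipschitz in space, Hoelder of exponent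
  \<open>\<alpha>\<close> in the centre.\<close>

locale holder_family =
  fixes F :: "real^'p::finite \<Rightarrow> real^'p \<Rightarrow> (real^'p) \<Rightarrow>\<^sub>L (real^'p)"
    and G :: "real^'p \<Rightarrow> real^'p \<Rightarrow> (real^'p) \<Rightarrow>\<^sub>L ((real^'p) \<Rightarrow>\<^sub>L (real^'p))"
    and x0 :: "real^'p" and R M \<alpha> :: real
  assumes R: "0 < R" "R \<le> 1" and M: "1 \<le> M" and \<alpha>: "0 < \<alpha>" "\<alpha> \<le> 1"
    and deriv: "\<And>c y u. c \<in> cball x0 R \<Longrightarrow> y \<in> cball x0 R \<Longrightarrow>
        ((\<lambda>y. F c y u) has_derivative G c y u) (at y)"
    and F_bound: "\<And>c y. c \<in> cball x0 R \<Longrightarrow> y \<in> cball x0 R \<Longrightarrow> norm (F c y) \<le> M"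
    and G_bound: "\<And>c y. c \<in> cball x0 R \<Longrightarrow> y \<in> cball x0 R \<Longrightarrow> norm (G c y) \<le> M"
    and F_holder: "\<And>c y c' y'. c \<in> cball x0 R \<Longrightarrow> y \<in> cball x0 R \<Longrightarrow>
        c' \<in> cball x0 R \<Longrightarrow> y' \<in> cball x0 R \<Longrightarrow>
        norm (F c y - F c' y') \<le> M * (norm (y - y') + norm (c - c') powr \<alpha>)"
    and G_holder: "\<And>c y c' y'. c \<in> cball x0 R \<Longrightarrow> y \<in> cball x0 R \<Longrightarrow>
        c' \<in> cball x0 R \<Longrightarrow> y' \<in> cball x0 R \<Longrightarrow>
        norm (G c y - G c' y') \<le> M * (norm (y - y') + norm (c - c') powr \<alpha>)"
begin

section \<open>Solution curves: existence, confinement, dependence on the data\<close>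

abbreviation K :: "(real^'p) set" where "K \<equiv> cball x0 R"

definition curve :: "real^'p \<Rightarrow> real^'p \<Rightarrow> (real \<Rightarrow> real^'p) \<Rightarrow> bool" where
  "curve u c \<phi> \<longleftrightarrow> integral_curve (\<lambda>y. F c y u) c \<phi>"

text \<open>The bound serves two purposes. A curve issued from \<open>N\<close> travels at most
  \<open>R / 4\<close>, hence stays in \<open>K\<close>; and since \<open>R \<le> 1\<close>, the
  field and its linearization have Lipschitz constant at most 1/4.\<close>

definition U :: "(real^'p) set" where "U = {u. norm u * M \<le> R / 4}"
definition N :: "(real^'p) set" where "N = cball x0 (R / 2)"

lemma N_sub: "c \<in> N \<Longrightarrow> c \<in> K"
  using R by (auto simp: N_def)

lemma U_le: "u \<in> U \<Longrightarrow> M * norm u \<le> 1 / 4"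
  using R by (auto simp: U_def mult.commute)

lemma U_le1: assumes "u \<in> U" shows "norm u \<le> 1"
proof -
  have "1 * norm u \<le> M * norm u" using M by (intro mult_right_mono) auto
  then show ?thesis using U_le[OF assms] by simp
qed

lemma F_apply_bound: "c \<in> K \<Longrightarrow> y \<in> K \<Longrightarrow> norm (F c y u) \<le> M * norm u"
  using F_bound by (meson mult_right_mono norm_blinfun norm_ge_zero order_trans)

lemma F_apply_holder:
  assumes "c \<in> K" "y \<in> K" "c' \<in> K" "y' \<in> K"
  shows "norm (F c y u - F c' y' u) \<le> M * norm u * (norm (y - y') + norm (c - c') powr \<alpha>)"
proof -
  have "norm (F c y u - F c' y' u) \<le> norm (F c y - F c' y') * norm u"
    by (metis blinfun.diff_left norm_blinfun)
  also have "\<dots> \<le> M * (norm (y - y') + norm (c - c') powr \<alpha>) * norm u"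
    by (intro mult_right_mono F_holder assms) auto
  finally show ?thesis by (simp add: mult_ac)
qed

lemma F_cont: assumes "c \<in> K" shows "continuous_on K (F c)"
proof -
  have "M-lipschitz_on K (F c)"
    using F_holder[OF assms _ assms] M by (intro lipschitz_onI) (auto simp: dist_norm)
  then show ?thesis by (rule lipschitz_on_continuous_on)
qed

lemma G_cont: assumes "c \<in> K" shows "continuous_on K (G c)"
proof -
  have "M-lipschitz_on K (G c)"
    using G_holder[OF assms _ assms] M by (intro lipschitz_onI) (auto simp: dist_norm)
  then show ?thesis by (rule lipschitz_on_continuous_on)
qed

lemma norm_diff_le_powr:
  assumes "c \<in> N" "c' \<in> N" shows "norm (c - c') \<le> norm (c - c') powr \<alpha>"
proof -
  have "norm (c - c') \<le> R / 2 + R / 2"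
    using assms by (intro norm_diff_triangle_le[of c x0]) (auto simp: N_def dist_norm norm_minus_commute)
  then have "norm (c - c') \<le> 1" using R by linarith
  then show ?thesis using powr_mono'[of \<alpha> 1 "norm (c - c')"] \<alpha> by simp
qed

lemma curveD:
  assumes "curve u c \<phi>"
  shows "\<phi> 0 = c" "t \<in> {0..1} \<Longrightarrow> (\<phi> has_vector_derivative F c (\<phi> t) u) (at t within {0..1})"
    "continuous_on {0..1} \<phi>"
  using assms unfolding curve_def integral_curve_def
  by (auto simp: continuous_on_eq_continuous_within intro!: has_vector_derivative_continuous)

lemma curve_exists:
  assumes u: "u \<in> U" and c: "c \<in> N"
  obtains \<phi> where "curve u c \<phi>"
proof -
  \<comment> \<open>The nearest-point projection onto the ball is 1-Lipschitz, so composing with it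
    gives a globally defined field with the same Lipschitz constant. The solution travels too little
    to leave the ball, hence solves the original equation.\<close>
  define pr where "pr = closest_point K"
  have pr: "pr y \<in> K" for y
    unfolding pr_def using R by (intro closest_point_in_set) auto
  have pr_id: "y \<in> K \<Longrightarrow> pr y = y" for y by (simp add: pr_def closest_point_self)
  have pr_lip: "norm (pr y - pr z) \<le> norm (y - z)" for y z
    unfolding pr_def dist_norm[symmetric] using R by (intro closest_point_lipschitz) auto
  have pr_cont: "continuous_on UNIV pr"
    unfolding pr_def using R by (intro continuous_on_closest_point) auto
  note cK = N_sub[OF c]
  obtain \<phi> where \<phi>: "\<phi> 0 = c"
    "\<And>t. t \<in> {0..1} \<Longrightarrow> (\<phi> has_vector_derivative F c (pr (\<phi> t)) u) (at t within {0..1})"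
  proof (rule picard_half_lipschitz[where c=c and G = "\<lambda>t y. F c (pr y) u"])
    fix \<psi> :: "real \<Rightarrow> real^'p" assume "continuous_on {0..1} \<psi>"
    then have "continuous_on {0..1} (\<lambda>t. pr (\<psi> t))"
      by (intro continuous_on_compose2[OF pr_cont]) auto
    then have "continuous_on {0..1} (\<lambda>t. F c (pr (\<psi> t)))"
      by (intro continuous_on_compose2[OF F_cont[OF cK]]) (use pr in auto)
    then show "continuous_on {0..1} (\<lambda>t. F c (pr (\<psi> t)) u)"
      by (intro continuous_intros)
  next
    fix y z
    have "norm (F c (pr y) u - F c (pr z) u) \<le> M * norm u * norm (pr y - pr z)"
      using F_apply_holder[OF cK pr cK pr, of y u z] by simp
    also have "\<dots> \<le> 1/2 * norm (y - z)"
      using U_le[OF u] pr_lip M by (intro mult_mono) auto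
    finally show "norm (F c (pr y) u - F c (pr z) u) \<le> norm (y - z) / 2" by simp
  qed blast
  have "\<phi> t \<in> K" if "t \<in> {0..1}" for t
  proof -
    have "norm (\<phi> t - \<phi> 0) \<le> (M * norm u) * t"
      by (rule norm_diff_le_interval[OF \<phi>(2) F_apply_bound[OF cK pr] that])
    also have "\<dots> \<le> M * norm u" using that M by (intro mult_left_le) auto
    finally have "dist c (\<phi> t) \<le> R/4" using u \<phi>(1) by (simp add: U_def dist_norm norm_minus_commute mult.commute)
    then have "dist x0 (\<phi> t) \<le> R"
      using c dist_triangle[of x0 "\<phi> t" c] R by (simp add: N_def)
    then show ?thesis by simp
  qed
  then have "curve u c \<phi>" unfolding curve_def integral_curve_def
    using \<phi> pr_id by simp
  then show thesis by (rule that)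
qed

text \<open>A curve leaving the ball would reach its boundary at a first time \<open>s\<close>, although up to that time
  its speed is too small.\<close>

lemma curve_stays:
  assumes u: "u \<in> U" and c: "c \<in> N" and \<phi>: "curve u c \<phi>" and t: "t \<in> {0..1}"
  shows "\<phi> t \<in> K"
proof (rule ccontr)
  assume "\<phi> t \<notin> K"
  define S where "S = {s \<in> {0..1}. R \<le> dist x0 (\<phi> s)}"
  have "closed S" unfolding S_def
    by (intro continuous_on_closed_Collect_le continuous_intros curveD(3)[OF \<phi>])
  moreover have "S \<noteq> {}" using \<open>\<phi> t \<notin> K\<close> t unfolding S_def by force
  moreover have "bdd_below S" unfolding S_def by (rule bdd_belowI[of _ 0]) auto
  ultimately have s: "Inf S \<in> S" by (intro closed_contains_Inf)
  define s where "s = Inf S"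
  have s01: "s \<in> {0..1}" and sR: "R \<le> dist x0 (\<phi> s)" using s by (auto simp: s_def S_def)
  have before: "dist x0 (\<phi> r) < R" if "r \<in> {0..<s}" for r
  proof (rule ccontr)
    assume "\<not> ?thesis"
    then have "r \<in> S" using that s01 by (auto simp: S_def)
    then have "s \<le> r" unfolding s_def by (intro cInf_lower \<open>bdd_below S\<close>)
    then show False using that by simp
  qed
  have "s \<noteq> 0" using sR c R by (auto simp: curveD(1)[OF \<phi>] N_def)
  obtain r where r: "r \<in> {0<..<s}" and "norm (\<phi> s - \<phi> 0) \<le> norm ((s - 0) *\<^sub>R F c (\<phi> r) u)"
  proof (atomize_elim, unfold Bex_def[symmetric], rule mvt_general)
    show "0 < s" using \<open>s \<noteq> 0\<close> s01 by simp
    show "continuous_on {0..s} \<phi>" using curveD(3)[OF \<phi>] s01 by (auto intro: continuous_on_subset)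
    show "(\<phi> has_derivative (\<lambda>h. h *\<^sub>R F c (\<phi> r) u)) (at r)" if "0 < r" "r < s" for r
      using curveD(2)[OF \<phi>, of r] that s01 at_within_interior[of r "{0..1}"]
      unfolding has_vector_derivative_def by simp
  qed
  note this(2)
  also have "\<dots> \<le> norm (F c (\<phi> r) u)" using s01 by (simp add: mult_left_le_one_le)
  also have "\<dots> \<le> M * norm u"
    using before[of r] r by (intro F_apply_bound[OF N_sub[OF c]]) auto
  also have "\<dots> \<le> R / 4" using u by (simp add: U_def mult.commute)
  finally have "dist c (\<phi> s) \<le> R/4" by (simp add: curveD(1)[OF \<phi>] dist_norm norm_minus_commute)
  then have "dist x0 (\<phi> s) < R"
    using c dist_triangle[of x0 "\<phi> s" c] R by (simp add: N_def)
  then show False using sR by simp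
qed

text \<open>The difference of the two velocities is split at \<open>F c' (\<psi> t) u\<close>: first
  the point and the centre change, with a half-Lipschitz bound that
  \<open>sup_le_of_deriv_half\<close> absorbs, then only \<open>u\<close> changes.\<close>

lemma curve_holder:
  assumes u: "u \<in> U" and c: "c \<in> N" and \<phi>: "curve u c \<phi>"
    and v: "v \<in> U" and c': "c' \<in> N" and \<psi>: "curve v c' \<psi>" and t: "t \<in> {0..1}"
  shows "norm (\<phi> t - \<psi> t) \<le> 3 * M * (norm (u - v) + norm (c - c') powr \<alpha>)"
proof -
  let ?H = "norm (c - c') powr \<alpha>"
  have "norm (\<phi> t - \<psi> t) \<le> 2 * (norm (\<phi> 0 - \<psi> 0) + (?H / 2 + M * norm (u - v)))"
  proof (rule sup_le_of_deriv_half[OF _ _ t])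
    fix t :: real assume t: "t \<in> {0..1}"
    show "((\<lambda>t. \<phi> t - \<psi> t) has_vector_derivative (F c (\<phi> t) u - F c' (\<psi> t) v)) (at t within {0..1})"
      by (intro has_vector_derivative_diff curveD(2)[OF \<phi>] curveD(2)[OF \<psi>] t)
    note K = curve_stays[OF u c \<phi> t] curve_stays[OF v c' \<psi> t] N_sub[OF c] N_sub[OF c']
    have "norm (F c (\<phi> t) u - F c' (\<psi> t) u) \<le> M * norm u * (norm (\<phi> t - \<psi> t) + ?H)"
      by (intro F_apply_holder K)
    also have "\<dots> \<le> 1/2 * (norm (\<phi> t - \<psi> t) + ?H)"
      using U_le[OF u] by (intro mult_right_mono) auto
    finally have 1: "norm (F c (\<phi> t) u - F c' (\<psi> t) u) \<le> norm (\<phi> t - \<psi> t) / 2 + ?H / 2"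
      by (simp add: field_simps)
    have "norm (F c' (\<psi> t) u - F c' (\<psi> t) v) \<le> M * norm (u - v)"
      using F_apply_bound[OF K(4,2), of "u - v"] by (simp add: blinfun.diff_right)
    then show "norm (F c (\<phi> t) u - F c' (\<psi> t) v)
        \<le> norm (\<phi> t - \<psi> t) / 2 + (?H / 2 + M * norm (u - v))"
      using 1 norm_triangle_ineq[of "F c (\<phi> t) u - F c' (\<psi> t) u" "F c' (\<psi> t) u - F c' (\<psi> t) v"]
      by simp
  qed
  also have "\<phi> 0 - \<psi> 0 = c - c'" using \<phi> \<psi> by (simp add: curveD(1))
  \<comment> \<open>The difference of the initial points is replaced by its power, so the Hoelder
    term gets the factor 2 (1 + 1/2) = 3.\<close>
  also have "2 * (norm (c - c') + (?H / 2 + M * norm (u - v))) \<le> 3 * ?H + 3 * M * norm (u - v)"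
    using norm_diff_le_powr[OF c c'] mult_nonneg_nonneg[of M "norm (u - v)"] M
    by (simp del: mult_nonneg_nonneg zero_le_mult_iff)
  also have "\<dots> \<le> 3 * M * ?H + 3 * M * norm (u - v)"
    using M by (intro add_right_mono mult_right_mono) auto
  finally show ?thesis by (simp add: algebra_simps)
qed

text \<open>For equal data the right-hand side of \<open>curve_holder\<close> is zero. This makes
  the definite description in \<open>exp_field\<close> meaningful.\<close>

lemma curve_unique:
  assumes "u \<in> U" "c \<in> N" "curve u c \<phi>" "curve u c \<psi>" "t \<in> {0..1}"
  shows "\<phi> t = \<psi> t"
  using curve_holder[OF assms(1-3) assms(1,2,4,5)] by simp

definition E :: "real^'p \<Rightarrow> real^'p \<Rightarrow> real^'p" where
  "E u c = exp_field (\<lambda>y. F c y u) c"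

lemma E_eq: assumes "u \<in> U" "c \<in> N" "curve u c \<phi>" shows "E u c = \<phi> 1"
  unfolding E_def exp_field_def
proof (rule the_equality)
  show "\<exists>\<psi>. integral_curve (\<lambda>y. F c y u) c \<psi> \<and> \<psi> 1 = \<phi> 1"
    using assms(3) curve_def by auto
  show "y = \<phi> 1" if "\<exists>\<psi>. integral_curve (\<lambda>y. F c y u) c \<psi> \<and> \<psi> 1 = y" for y
    using that curve_unique[OF assms(1-2) _ assms(3), of _ 1] by (auto simp: curve_def)
qed

text \<open>\<open>W t\<close> is the candidate for the derivative of the curve at time
  \<open>t\<close> with respect to \<open>u\<close>. It starts at 0 because the initial point does
  not depend on \<open>u\<close>, and linearity of the field in \<open>u\<close> makes the
  inhomogeneous term \<open>F c (\<phi> t)\<close>.\<close>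

definition variation :: "real^'p \<Rightarrow> real^'p \<Rightarrow> (real \<Rightarrow> real^'p) \<Rightarrow> (real \<Rightarrow> (real^'p) \<Rightarrow>\<^sub>L (real^'p)) \<Rightarrow> bool"
  where "variation u c \<phi> W \<longleftrightarrow> curve u c \<phi> \<and> W 0 = 0 \<and>
    (\<forall>t\<in>{0..1}. (W has_vector_derivative ((G c (\<phi> t) u o\<^sub>L W t) + F c (\<phi> t))) (at t within {0..1}))"

lemma G_apply_bound: "c \<in> K \<Longrightarrow> y \<in> K \<Longrightarrow> norm (G c y u) \<le> M * norm u"
  using G_bound by (meson mult_right_mono norm_blinfun norm_ge_zero order_trans)

lemma G_compose_bound:
  assumes "u \<in> U" "c \<in> K" "y \<in> K" shows "norm (G c y u o\<^sub>L A) \<le> norm A / 2"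
proof -
  have "norm (G c y u o\<^sub>L A) \<le> norm (G c y u) * norm A" by (rule norm_blinfun_compose)
  also have "\<dots> \<le> 1/2 * norm A"
    using G_apply_bound[OF assms(2,3), of u] U_le[OF assms(1)] by (intro mult_right_mono) auto
  finally show ?thesis by simp
qed

lemma variation_exists:
  assumes u: "u \<in> U" and c: "c \<in> N" and \<phi>: "curve u c \<phi>"
  obtains W where "variation u c \<phi> W"
proof -
  have "\<phi> ` {0..1} \<subseteq> K" using curve_stays[OF u c \<phi>] by auto
  then have cont: "continuous_on {0..1} (\<lambda>t. G c (\<phi> t))" "continuous_on {0..1} (\<lambda>t. F c (\<phi> t))"
    using continuous_on_compose2[OF G_cont[OF N_sub[OF c]] curveD(3)[OF \<phi>]]
      continuous_on_compose2[OF F_cont[OF N_sub[OF c]] curveD(3)[OF \<phi>]] by auto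
  obtain W where "W 0 = 0" "\<And>t. t \<in> {0..1} \<Longrightarrow>
      (W has_vector_derivative ((G c (\<phi> t) u o\<^sub>L W t) + F c (\<phi> t))) (at t within {0..1})"
  proof (rule picard_half_lipschitz[where c=0 and G = "\<lambda>t A. (G c (\<phi> t) u o\<^sub>L A) + F c (\<phi> t)"])
    show "continuous_on {0..1} (\<lambda>t. (G c (\<phi> t) u o\<^sub>L \<psi> t) + F c (\<phi> t))" if "continuous_on {0..1} \<psi>" for \<psi>
      by (intro continuous_intros cont that bounded_bilinear.continuous_on[OF bounded_bilinear_blinfun_compose])
    show "norm (((G c (\<phi> t) u o\<^sub>L y) + F c (\<phi> t)) - ((G c (\<phi> t) u o\<^sub>L z) + F c (\<phi> t))) \<le> norm (y - z) / 2"
      if "t \<in> {0..1}" for t y z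
      using G_compose_bound[OF u N_sub[OF c] curve_stays[OF u c \<phi> that], of "y - z"]
      by (simp add: bounded_bilinear.diff_right[OF bounded_bilinear_blinfun_compose])
  qed blast
  then have "variation u c \<phi> W" using \<phi> by (simp add: variation_def)
  then show thesis by (rule that)
qed

lemma variation_bound:
  assumes u: "u \<in> U" and c: "c \<in> N" and W: "variation u c \<phi> W" and t: "t \<in> {0..1}"
  shows "norm (W t) \<le> 2 * M"
proof -
  have \<phi>: "curve u c \<phi>" and "W 0 = 0" using W by (auto simp: variation_def)
  have "norm (W t) \<le> 2 * (norm (W 0) + M)"
  proof (rule sup_le_of_deriv_half[OF _ _ t])
    fix t :: real assume t: "t \<in> {0..1}"
    show "(W has_vector_derivative ((G c (\<phi> t) u o\<^sub>L W t) + F c (\<phi> t))) (at t within {0..1})"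
      using W t by (simp add: variation_def)
    note K = N_sub[OF c] curve_stays[OF u c \<phi> t]
    show "norm ((G c (\<phi> t) u o\<^sub>L W t) + F c (\<phi> t)) \<le> norm (W t) / 2 + M"
      by (intro norm_triangle_le add_mono G_compose_bound[OF u K] F_bound[OF K])
  qed
  then show ?thesis using \<open>W 0 = 0\<close> by simp
qed

text \<open>The variational equation has coefficients evaluated along the curve, whose own
  dependence on the data is given by \<open>curve_holder\<close>; Lipschitz and Hoelder bounds for
  \<open>F\<close> and \<open>G\<close> turn it into the same modulus for \<open>W\<close>.\<close>

lemma variation_holder:
  assumes u: "u \<in> U" and c: "c \<in> N" and W: "variation u c \<phi> W"
    and v: "v \<in> U" and c': "c' \<in> N" and V: "variation v c' \<psi> V" and t: "t \<in> {0..1}"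
  shows "norm (W t - V t) \<le> 40 * M^3 * (norm (u - v) + norm (c - c') powr \<alpha>)"
proof -
  define \<Delta> where "\<Delta> = norm (u - v) + norm (c - c') powr \<alpha>"
  have \<Delta>: "norm (u - v) \<le> \<Delta>" "norm (c - c') powr \<alpha> \<le> \<Delta>" "0 \<le> \<Delta>" by (auto simp: \<Delta>_def)
  have \<phi>: "curve u c \<phi>" "W 0 = 0" and \<psi>: "curve v c' \<psi>" "V 0 = 0" using W V by (auto simp: variation_def)
  have "norm (W t - V t) \<le> 2 * (norm (W 0 - V 0) + 20 * M^3 * \<Delta>)"
  proof (rule sup_le_of_deriv_half[OF _ _ t])
    fix t :: real assume t: "t \<in> {0..1}"
    let ?w = "(G c (\<phi> t) u o\<^sub>L W t) + F c (\<phi> t)" and ?v = "(G c' (\<psi> t) v o\<^sub>L V t) + F c' (\<psi> t)"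
    show "((\<lambda>t. W t - V t) has_vector_derivative (?w - ?v)) (at t within {0..1})"
      using W V t by (intro has_vector_derivative_diff) (auto simp: variation_def)
    note K = N_sub[OF c] curve_stays[OF u c \<phi>(1) t] N_sub[OF c'] curve_stays[OF v c' \<psi>(1) t]
    have "norm (\<phi> t - \<psi> t) + norm (c - c') powr \<alpha> \<le> 3 * M * \<Delta> + \<Delta>"
      using curve_holder[OF u c \<phi>(1) v c' \<psi>(1) t] \<Delta>(2) unfolding \<Delta>_def by (rule add_mono)
    also have "\<dots> \<le> 4 * M * \<Delta>" using M \<Delta>(3) mult_right_mono[of 1 M \<Delta>] by simp
    finally have dist: "norm (\<phi> t - \<psi> t) + norm (c - c') powr \<alpha> \<le> 4 * M * \<Delta>" .
    have FF: "norm (F c (\<phi> t) - F c' (\<psi> t)) \<le> M * (4 * M * \<Delta>)"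
      using M by (intro order_trans[OF F_holder[OF K]] mult_left_mono dist) auto
    have GG: "norm (G c (\<phi> t) - G c' (\<psi> t)) \<le> M * (4 * M * \<Delta>)"
      using M by (intro order_trans[OF G_holder[OF K]] mult_left_mono dist) auto
    have "G c (\<phi> t) u - G c' (\<psi> t) v = (G c (\<phi> t) - G c' (\<psi> t)) u + G c' (\<psi> t) (u - v)"
      by (simp add: blinfun.bilinear_simps)
    then have "norm (G c (\<phi> t) u - G c' (\<psi> t) v)
        \<le> norm ((G c (\<phi> t) - G c' (\<psi> t)) u) + norm (G c' (\<psi> t) (u - v))"
      by (metis norm_triangle_ineq)
    also have "\<dots> \<le> M * (4 * M * \<Delta>) * 1 + M * \<Delta>"
    proof (rule add_mono)
      show "norm ((G c (\<phi> t) - G c' (\<psi> t)) u) \<le> M * (4 * M * \<Delta>) * 1"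
        using M \<Delta>(3) by (intro order_trans[OF norm_blinfun] mult_mono GG U_le1 u) auto
      show "norm (G c' (\<psi> t) (u - v)) \<le> M * \<Delta>"
        using M by (intro order_trans[OF G_apply_bound[OF K(3,4)]] mult_left_mono \<Delta>) auto
    qed
    also have "\<dots> \<le> 4 * M^2 * \<Delta> + M^2 * \<Delta>"
      using M \<Delta>(3) mult_right_mono[of 1 M "M * \<Delta>"] by (simp add: power2_eq_square)
    finally have "norm (G c (\<phi> t) u - G c' (\<psi> t) v) \<le> 5 * M^2 * \<Delta>" by (simp add: algebra_simps)
    then have GV: "norm ((G c (\<phi> t) u - G c' (\<psi> t) v) o\<^sub>L V t) \<le> 5 * M^2 * \<Delta> * (2 * M)"
      using variation_bound[OF v c' V t] by (meson mult_mono norm_blinfun_compose norm_ge_zero order_trans)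
    \<comment> \<open>Only the first summand contains the unknown difference, with a factor at most
      1/2; the others are forcing terms of size \<open>\<Delta>\<close>, the middle one because
      \<open>V\<close> is bounded by \<open>2 * M\<close>.\<close>
    have "?w - ?v = (G c (\<phi> t) u o\<^sub>L (W t - V t)) + ((G c (\<phi> t) u - G c' (\<psi> t) v) o\<^sub>L V t)
        + (F c (\<phi> t) - F c' (\<psi> t))"
      by (simp add: bounded_bilinear.diff_left[OF bounded_bilinear_blinfun_compose]
          bounded_bilinear.diff_right[OF bounded_bilinear_blinfun_compose])
    then have "norm (?w - ?v) \<le> norm (G c (\<phi> t) u o\<^sub>L (W t - V t))
        + norm ((G c (\<phi> t) u - G c' (\<psi> t) v) o\<^sub>L V t) + norm (F c (\<phi> t) - F c' (\<psi> t))"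
      by (metis norm_triangle_mono norm_triangle_ineq order_refl)
    also have "\<dots> \<le> norm (W t - V t) / 2 + 5 * M^2 * \<Delta> * (2 * M) + M * (4 * M * \<Delta>)"
      by (intro add_mono G_compose_bound[OF u K(1,2)] GV FF)
    \<comment> \<open>The contributions 10 and 4 are rounded up to 20, which
      \<open>sup_le_of_deriv_half\<close> doubles to the 40 of the statement.\<close>
    also have "\<dots> \<le> norm (W t - V t) / 2 + 20 * M^3 * \<Delta>"
      using M \<Delta>(3) mult_right_mono[of 1 M "M * M * \<Delta>"] by (simp add: power2_eq_square power3_eq_cube)
    finally show "norm (?w - ?v) \<le> norm (W t - V t) / 2 + 20 * M^3 * \<Delta>" .
  qed
  then show ?thesis using \<phi>(2) \<psi>(2) by (simp add: \<Delta>_def)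
qed

section \<open>First-order expansion of the flow with quadratic remainder\<close>

lemma F_linearization:
  assumes c: "c \<in> K" and y: "y \<in> K" "y' \<in> K"
  shows "norm (F c y' u - F c y u - G c y u (y' - y)) \<le> M * norm u * (norm (y' - y))^2"
proof -
  let ?S = "closed_segment y y'"
  have SK: "?S \<subseteq> K" using y by (intro closed_segment_subset convex_cball)
  have "norm (F c y' u - F c y u - G c y u (y' - y)) \<le> norm (y' - y) * (M * norm u * norm (y' - y))"
  proof (rule differentiable_bound_linearization[where f="\<lambda>y. F c y u" and S="?S"
        and f'="\<lambda>z. blinfun_apply (G c z u)"])
    show "y + t *\<^sub>R (y' - y) \<in> ?S" if "t \<in> {0..1}" for t
      unfolding in_segment using that by (intro exI[of _ t]) (auto simp: algebra_simps)
    show "((\<lambda>y. F c y u) has_derivative G c z u) (at z within ?S)" if "z \<in> ?S" for z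
      using that SK by (auto intro!: has_derivative_at_withinI[OF deriv[OF c]])
    show "onorm (blinfun_apply (G c z u) - blinfun_apply (G c y u)) \<le> M * norm u * norm (y' - y)" if z: "z \<in> ?S" for z
    proof -
      have "norm (G c z - G c y) \<le> M * (norm (z - y) + norm (c - c) powr \<alpha>)"
        using z SK by (intro G_holder c y) auto
      also have "\<dots> \<le> M * norm (y' - y)"
        using segment_bound1[OF z] M by (simp add: norm_minus_commute)
      finally have "norm ((G c z - G c y) u) \<le> M * norm (y' - y) * norm u"
        by (intro order_trans[OF norm_blinfun] mult_right_mono) auto
      then show ?thesis
        by (simp add: norm_blinfun.rep_eq blinfun.diff_left minus_blinfun.rep_eq fun_diff_def mult_ac)
    qed
  qed auto
  then show ?thesis by (simp add: power2_eq_square mult_ac)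
qed

text \<open>The remainder \<open>d\<close> satisfies the homogeneous variational equation up to
  forcing terms quadratic in \<open>v - u\<close>, and it vanishes at time 0. The uniform quadratic
  bound identifies \<open>W 1\<close> as the derivative of the flow in \<open>u\<close>.\<close>

lemma E_linearization:
  assumes u: "u \<in> U" and v: "v \<in> U" and c: "c \<in> N" and W: "variation u c \<phi> W"
  shows "norm (E v c - E u c - W 1 (v - u)) \<le> 24 * M^2 * (norm (v - u))^2"
proof -
  let ?\<Delta> = "norm (v - u)"
  obtain \<psi> where \<psi>: "curve v c \<psi>" using curve_exists[OF v c] .
  have \<phi>: "curve u c \<phi>" and "W 0 = 0" using W by (auto simp: variation_def)
  define d where "d t = \<psi> t - \<phi> t - W t (v - u)" for t
  have "norm (d 1) \<le> 2 * (norm (d 0) + 12 * M^2 * ?\<Delta>^2)"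
  proof (rule sup_le_of_deriv_half)
    fix t :: real assume t: "t \<in> {0..1}"
    let ?g = "F c (\<psi> t) v - F c (\<phi> t) u - ((G c (\<phi> t) u o\<^sub>L W t) + F c (\<phi> t)) (v - u)"
    have "(W has_vector_derivative ((G c (\<phi> t) u o\<^sub>L W t) + F c (\<phi> t))) (at t within {0..1})"
      using W t by (simp add: variation_def)
    then have "((\<lambda>t. W t (v - u)) has_vector_derivative (((G c (\<phi> t) u o\<^sub>L W t) + F c (\<phi> t)) (v - u)))
        (at t within {0..1})"
      by (rule bounded_linear.has_vector_derivative[OF blinfun.bounded_linear_left])
    then show "(d has_vector_derivative ?g) (at t within {0..1})"
      unfolding d_def by (intro has_vector_derivative_diff curveD(2)[OF \<phi>] curveD(2)[OF \<psi>] t)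
    note K = N_sub[OF c] curve_stays[OF u c \<phi> t] curve_stays[OF v c \<psi> t]
    have dist: "norm (\<psi> t - \<phi> t) \<le> 3 * M * ?\<Delta>"
      using curve_holder[OF v c \<psi> u c \<phi> t] by simp
    \<comment> \<open>The three groups are the Taylor remainder of the field in space, the linear
      term in \<open>d\<close>, and the mixed increment in space and in \<open>u\<close>.\<close>
    have "?g = (F c (\<psi> t) u - F c (\<phi> t) u - G c (\<phi> t) u (\<psi> t - \<phi> t)) + G c (\<phi> t) u (d t)
        + (F c (\<psi> t) (v - u) - F c (\<phi> t) (v - u))"
      by (simp add: d_def blinfun.bilinear_simps)
    then have "norm ?g \<le> norm (F c (\<psi> t) u - F c (\<phi> t) u - G c (\<phi> t) u (\<psi> t - \<phi> t))
        + norm (G c (\<phi> t) u (d t)) + norm (F c (\<psi> t) (v - u) - F c (\<phi> t) (v - u))"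
      by (metis norm_triangle_mono norm_triangle_ineq order_refl)
    also have "\<dots> \<le> M * norm u * (3 * M * ?\<Delta>)^2 + norm (d t) / 2 + M * ?\<Delta> * (3 * M * ?\<Delta>)"
    proof (intro add_mono)
      show "norm (F c (\<psi> t) u - F c (\<phi> t) u - G c (\<phi> t) u (\<psi> t - \<phi> t)) \<le> M * norm u * (3 * M * ?\<Delta>)^2"
        using M by (intro order_trans[OF F_linearization[OF K]] mult_left_mono power_mono dist) auto
      have "norm (G c (\<phi> t) u) \<le> 1 / 2"
        using G_apply_bound[OF K(1,2), of u] U_le[OF u] by simp
      then have "norm (G c (\<phi> t) u (d t)) \<le> 1 / 2 * norm (d t)"
        by (intro order_trans[OF norm_blinfun[of "G c (\<phi> t) u"]] mult_right_mono) auto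
      then show "norm (G c (\<phi> t) u (d t)) \<le> norm (d t) / 2" by simp
      show "norm (F c (\<psi> t) (v - u) - F c (\<phi> t) (v - u)) \<le> M * ?\<Delta> * (3 * M * ?\<Delta>)"
        using F_apply_holder[OF K(1,3,1,2), of "v - u"] M dist
        by (auto intro!: mult_left_mono elim!: order_trans)
    qed
    \<comment> \<open>With \<open>M * norm u\<close> bounded by 1 the first term contributes 9, the
      mixed term 3; their sum 12 is doubled to 24.\<close>
    also have "M * norm u * (3 * M * ?\<Delta>)^2 \<le> 1 * (3 * M * ?\<Delta>)^2"
      using U_le[OF u] by (intro mult_right_mono) auto
    finally show "norm ?g \<le> norm (d t) / 2 + 12 * M^2 * ?\<Delta>^2"
      by (simp add: power2_eq_square algebra_simps)
  qed auto
  moreover have "d 0 = 0" using curveD(1)[OF \<phi>] curveD(1)[OF \<psi>] \<open>W 0 = 0\<close> by (simp add: d_def)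
  moreover have "d 1 = E v c - E u c - W 1 (v - u)"
    by (simp add: d_def E_eq[OF u c \<phi>] E_eq[OF v c \<psi>])
  ultimately show ?thesis by simp
qed

lemma zero_in_U: "0 \<in> U" using R by (simp add: U_def)

lemma curve_zero: "curve 0 c (\<lambda>_. c)"
  by (simp add: curve_def integral_curve_def)

lemma E_zero: "c \<in> N \<Longrightarrow> E 0 c = c"
  using E_eq[OF zero_in_U _ curve_zero] by simp

text \<open>For \<open>u = 0\<close> the curve is constant and the equation reduces to a constant
  right-hand side. Hence the derivative of the flow at \<open>u = 0\<close> is the frame
  \<open>F c c\<close> itself.\<close>

lemma variation_zero: "variation 0 c (\<lambda>_. c) (\<lambda>t. t *\<^sub>R F c c)"
  unfolding variation_def using curve_zero
  by (auto intro!: derivative_eq_intros)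

theorem flow_parameter_estimates:
  obtains D C where "C \<ge> 0"
    "\<And>u c. u \<in> U \<Longrightarrow> c \<in> N \<Longrightarrow> \<exists>\<phi>. integral_curve (\<lambda>y. F c y u) c \<phi>"
    "\<And>c. c \<in> N \<Longrightarrow> E 0 c = c" "\<And>c. c \<in> N \<Longrightarrow> D 0 c = F c c"
    "\<And>u c v c'. u \<in> U \<Longrightarrow> c \<in> N \<Longrightarrow> v \<in> U \<Longrightarrow> c' \<in> N \<Longrightarrow>
      norm (E u c - E v c') \<le> C * (norm (u - v) + norm (c - c') powr \<alpha>)"
    "\<And>u c v c'. u \<in> U \<Longrightarrow> c \<in> N \<Longrightarrow> v \<in> U \<Longrightarrow> c' \<in> N \<Longrightarrow>
      norm (D u c - D v c') \<le> C * (norm (u - v) + norm (c - c') powr \<alpha>)"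
    "\<And>u v c. u \<in> U \<Longrightarrow> v \<in> U \<Longrightarrow> c \<in> N \<Longrightarrow>
      norm (E v c - E u c - blinfun_apply (D u c) (v - u)) \<le> C * (norm (v - u))^2"
proof -
  have "\<exists>\<phi> W. variation u c \<phi> W" if "u \<in> U" "c \<in> N" for u c
    using that curve_exists variation_exists by metis
  then obtain \<Phi> W where W: "\<And>u c. u \<in> U \<Longrightarrow> c \<in> N \<Longrightarrow> variation u c (\<Phi> u c) (W u c)"
    by metis
  then have \<Phi>: "\<And>u c. u \<in> U \<Longrightarrow> c \<in> N \<Longrightarrow> curve u c (\<Phi> u c)"
    by (simp add: variation_def)
  define C where "C = 40 * M^3 + 3 * M + 24 * M^2"
  have C: "0 \<le> C" "40 * M^3 \<le> C" "3 * M \<le> C" "24 * M^2 \<le> C"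
    using M by (auto simp: C_def)
  show thesis
  proof (rule that[of C "\<lambda>u c. W u c 1"])
    show "\<exists>\<phi>. integral_curve (\<lambda>y. F c y u) c \<phi>" if "u \<in> U" "c \<in> N" for u c
      using \<Phi>[OF that] by (auto simp: curve_def)
    \<comment> \<open>\<open>W\<close> was obtained by choice; \<open>variation_holder\<close> with
      equal data is a uniqueness statement and identifies it with the explicit solution.\<close>
    show "W 0 c 1 = F c c" if "c \<in> N" for c
      using variation_holder[OF zero_in_U that W[OF zero_in_U that] zero_in_U that variation_zero, of 1]
      by simp
    show "norm (E u c - E v c') \<le> C * (norm (u - v) + norm (c - c') powr \<alpha>)"
      if "u \<in> U" "c \<in> N" "v \<in> U" "c' \<in> N" for u c v c'
      unfolding E_eq[OF that(1,2) \<Phi>[OF that(1,2)]] E_eq[OF that(3,4) \<Phi>[OF that(3,4)]]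
      by (rule order_trans[OF curve_holder[OF that(1,2) \<Phi>[OF that(1,2)] that(3,4) \<Phi>[OF that(3,4)]]])
        (auto intro: mult_right_mono C)
    show "norm (W u c 1 - W v c' 1) \<le> C * (norm (u - v) + norm (c - c') powr \<alpha>)"
      if "u \<in> U" "c \<in> N" "v \<in> U" "c' \<in> N" for u c v c'
      by (rule order_trans[OF variation_holder[OF that(1,2) W[OF that(1,2)] that(3,4) W[OF that(3,4)]]])
        (auto intro: mult_right_mono C)
    show "norm (E v c - E u c - W u c 1 (v - u)) \<le> C * (norm (v - u))^2"
      if "u \<in> U" "v \<in> U" "c \<in> N" for u v c
      by (rule order_trans[OF E_linearization[OF that W[OF that(1,3)]]])
        (auto intro: mult_right_mono C)
  qed (use C E_zero in auto)
qed

end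

section \<open>Inverses of near-linear maps\<close>

lemma has_derivative_of_quadratic_bound:
  assumes S: "open S" "u \<in> S" and L: "bounded_linear L"
    and est: "\<And>v. v \<in> S \<Longrightarrow> norm (f v - f u - L (v - u)) \<le> C * (norm (v - u))^2"
  shows "(f has_derivative L) (at u)"
proof -
  obtain e where e: "0 < e" "ball u e \<subseteq> S" using S openE by blast
  show ?thesis
  proof (rule has_derivativeI_sandwich[OF e(1) L])
    fix v assume "v \<noteq> u" "dist v u < e"
    then have "v \<in> S" using e(2) by (auto simp: dist_commute)
    then show "norm (f v - f u - L (v - u)) / norm (v - u) \<le> C * norm (v - u)"
      using est[of v] \<open>v \<noteq> u\<close> by (simp add: divide_simps power2_eq_square mult_ac)
  next
    have "((\<lambda>v. C * norm (v - u)) \<longlongrightarrow> C * norm (u - u)) (at u)"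
      by (intro tendsto_intros)
    then show "((\<lambda>v. C * norm (v - u)) \<longlongrightarrow> 0) (at u)" by simp
  qed
qed

lemma linear_bounded_below_inv:
  fixes L :: "'a::euclidean_space \<Rightarrow> 'a"
  assumes L: "linear L" and below: "\<And>h. m * norm h \<le> norm (L h)" and "0 < m"
  shows "linear (inv L)" "L (inv L k) = k" "inv L (L h) = h" "norm (inv L k) \<le> norm k / m"
proof -
  have inj: "inj L"
  proof (rule linear_injective_0[OF L, THEN iffD2], intro allI impI)
    fix h assume "L h = 0"
    then have "m * norm h \<le> 0" using below[of h] by simp
    then show "h = 0" using \<open>0 < m\<close> by (simp add: mult_le_0_iff)
  qed
  then have "surj L" using L linear_injective_imp_surjective by blast
  then show inv: "L (inv L k) = k" for k by (rule surj_f_inv_f)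
  show "inv L (L h) = h" using inj by simp
  show "linear (inv L)" by (rule inj_linear_imp_inv_linear[OF L inj])
  show "norm (inv L k) \<le> norm k / m"
    using below[of "inv L k"] inv[of k] \<open>0 < m\<close> by (simp add: field_simps)
qed

text \<open>\<open>m\<close> measures the invertibility of the model map \<open>D 0 x\<close>.
  Derivatives within \<open>m / 4\<close> of it keep the lower bound \<open>m / 2\<close>, and
  \<open>\<delta> \<le> m * \<rho> / 8\<close> ensures that \<open>x\<close> is reached from every
  centre in the ball.\<close>

locale near_linear_family =
  fixes E :: "real^'p::finite \<Rightarrow> real^'p \<Rightarrow> real^'p"
    and D :: "real^'p \<Rightarrow> real^'p \<Rightarrow> (real^'p) \<Rightarrow>\<^sub>L (real^'p)"
    and x :: "real^'p" and \<rho> \<delta> C m \<alpha> :: real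
  assumes pos: "0 < \<rho>" "0 < \<delta>" "0 < m" "0 \<le> C" and \<delta>_small: "\<delta> \<le> m * \<rho> / 8"
    and E_zero: "\<And>c. c \<in> ball x \<delta> \<Longrightarrow> E 0 c = c"
    and E_holder: "\<And>u c v c'. u \<in> ball 0 \<rho> \<Longrightarrow> c \<in> ball x \<delta> \<Longrightarrow> v \<in> ball 0 \<rho> \<Longrightarrow> c' \<in> ball x \<delta> \<Longrightarrow>
      norm (E u c - E v c') \<le> C * (norm (u - v) + norm (c - c') powr \<alpha>)"
    and D_holder: "\<And>u c v c'. u \<in> ball 0 \<rho> \<Longrightarrow> c \<in> ball x \<delta> \<Longrightarrow> v \<in> ball 0 \<rho> \<Longrightarrow> c' \<in> ball x \<delta> \<Longrightarrow>
      norm (D u c - D v c') \<le> C * (norm (u - v) + norm (c - c') powr \<alpha>)"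
    and E_linearization: "\<And>u v c. u \<in> ball 0 \<rho> \<Longrightarrow> v \<in> ball 0 \<rho> \<Longrightarrow> c \<in> ball x \<delta> \<Longrightarrow>
      norm (E v c - E u c - D u c (v - u)) \<le> C * (norm (v - u))^2"
    and below: "\<And>h. m * norm h \<le> norm (D 0 x h)"
    and D_near: "\<And>u c. u \<in> ball 0 \<rho> \<Longrightarrow> c \<in> ball x \<delta> \<Longrightarrow> norm (D u c - D 0 x) \<le> m / 4"
begin

abbreviation B where "B \<equiv> ball (0 :: real^'p) \<rho>"
abbreviation V where "V \<equiv> ball x \<delta>"

definition T :: "real^'p \<Rightarrow> real^'p \<Rightarrow> real^'p" where
  "T c = inv_into B (\<lambda>u. E u c)"

lemma E_deriv: "u \<in> B \<Longrightarrow> c \<in> V \<Longrightarrow> ((\<lambda>u. E u c) has_derivative D u c) (at u)"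
  by (rule has_derivative_of_quadratic_bound[of B])
    (auto intro: blinfun.bounded_linear_right E_linearization simp del: mem_ball)

lemma D_below:
  assumes "u \<in> B" "c \<in> V" shows "m / 2 * norm h \<le> norm (D u c h)"
proof -
  have "norm ((D u c - D 0 x) h) \<le> m / 4 * norm h"
    by (intro order_trans[OF norm_blinfun] mult_right_mono D_near assms) auto
  then have "norm (D u c h - D 0 x h) \<le> m / 4 * norm h" by (simp add: blinfun.diff_left)
  moreover have "norm (D 0 x h) - norm (D u c h) \<le> norm (D u c h - D 0 x h)"
    by (metis norm_minus_commute norm_triangle_ineq2)
  ultimately show ?thesis using below[of h] mult_nonneg_nonneg[of m "norm h"] pos
    by (simp del: mult_nonneg_nonneg zero_le_mult_iff)
qed

text \<open>The mean value inequality on the convex ball, applied to \<open>E u c - D 0 x u\<close>,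
  whose derivative is at most \<open>m / 4\<close> by \<open>D_near\<close>.\<close>

lemma E_near_linear:
  assumes "u \<in> B" "v \<in> B" "c \<in> V"
  shows "norm (E u c - E v c - D 0 x (u - v)) \<le> m / 4 * norm (u - v)"
proof -
  have "norm ((E u c - D 0 x u) - (E v c - D 0 x v)) \<le> m / 4 * norm (u - v)"
  proof (rule differentiable_bound[where S=B and f'="\<lambda>w. blinfun_apply (D w c - D 0 x)"])
    show "((\<lambda>u. E u c - D 0 x u) has_derivative (D w c - D 0 x)) (at w within B)" if "w \<in> B" for w
    proof -
      have "((\<lambda>u. E u c - D 0 x u) has_derivative (\<lambda>h. D w c h - D 0 x h)) (at w within B)"
        by (intro has_derivative_diff has_derivative_at_withinI[OF E_deriv] that assms
          bounded_linear_imp_has_derivative blinfun.bounded_linear_right)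
      then show ?thesis by (simp add: blinfun.diff_left[abs_def])
    qed
    show "onorm (D w c - D 0 x) \<le> m / 4" if "w \<in> B" for w
      using D_near[OF that assms(3)] by (simp add: norm_blinfun.rep_eq)
  qed (use assms in auto)
  then show ?thesis by (simp add: blinfun.diff_right algebra_simps)
qed

lemma E_below:
  assumes "u \<in> B" "v \<in> B" "c \<in> V"
  shows "m / 2 * norm (u - v) \<le> norm (E u c - E v c)"
proof -
  have "norm (D 0 x (u - v)) - norm (E u c - E v c) \<le> norm (E u c - E v c - D 0 x (u - v))"
    by (metis norm_minus_commute norm_triangle_ineq2)
  then show ?thesis using E_near_linear[OF assms] below[of "u - v"]
    mult_nonneg_nonneg[of m "norm (u - v)"] pos
    by (simp del: mult_nonneg_nonneg zero_le_mult_iff)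
qed

lemma E_inj: assumes "c \<in> V" shows "inj_on (\<lambda>u. E u c) B"
proof (rule inj_onI)
  fix u v assume "u \<in> B" "v \<in> B" "E u c = E v c"
  then have "m / 2 * norm (u - v) \<le> 0" using E_below[of u v c] assms by simp
  then show "u = v" using pos by (simp add: mult_le_0_iff)
qed

text \<open>Invariance of domain: the map is continuous and injective on an open ball of the same
  dimension.\<close>

lemma E_open: assumes "c \<in> V" shows "open ((\<lambda>u. E u c) ` B)"
proof (rule invariance_of_domain)
  show "continuous_on B (\<lambda>u. E u c)"
    using E_deriv[OF _ assms] by (meson continuous_at_imp_continuous_on has_derivative_continuous)
qed (use E_inj assms in auto)

lemma T_in: "y \<in> (\<lambda>u. E u c) ` B \<Longrightarrow> T c y \<in> B"
  and E_T: "y \<in> (\<lambda>u. E u c) ` B \<Longrightarrow> E (T c y) c = y"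
  unfolding T_def by (rule inv_into_into, assumption) (rule f_inv_into_f[where f="\<lambda>u. E u c"])

text \<open>Both preimages are inserted into the flow with the same centre \<open>c\<close>, where
  the lower bound \<open>E_below\<close> applies. Returning to the centre \<open>c'\<close> in the
  second one costs the Hoelder modulus of \<open>E\<close> at fixed \<open>u\<close>.\<close>

lemma T_holder:
  assumes c: "c \<in> V" "y \<in> (\<lambda>u. E u c) ` B" and c': "c' \<in> V" "y' \<in> (\<lambda>u. E u c') ` B"
  shows "norm (T c y - T c' y') \<le> 2 / m * (norm (y - y') + C * norm (c - c') powr \<alpha>)"
proof -
  note T = T_in[OF c(2)] T_in[OF c'(2)]
  have "m / 2 * norm (T c y - T c' y') \<le> norm (E (T c y) c - E (T c' y') c)"
    by (intro E_below T c)
  also have "E (T c y) c - E (T c' y') c = (y - y') - (E (T c' y') c - E (T c' y') c')"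
    by (simp add: E_T c c')
  also have "norm \<dots> \<le> norm (y - y') + norm (E (T c' y') c - E (T c' y') c')"
    by (rule norm_triangle_ineq4)
  also have "\<dots> \<le> norm (y - y') + C * norm (c - c') powr \<alpha>"
    using E_holder[OF T(2) c(1) T(2) c'(1)] by simp
  finally show ?thesis using pos by (simp add: field_simps)
qed

section \<open>The derivative of the inverse map\<close>

definition J :: "real^'p \<Rightarrow> real^'p \<Rightarrow> real^'p \<Rightarrow> real^'p" where
  "J u c = inv (blinfun_apply (D u c))"

lemma J:
  assumes "u \<in> B" "c \<in> V"
  shows "linear (J u c)" "D u c (J u c k) = k" "J u c (D u c h) = h" "norm (J u c k) \<le> 2 / m * norm k"
  using linear_bounded_below_inv[OF _ D_below[OF assms]] pos bounded_linear.linear[OF blinfun.bounded_linear_right]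
  unfolding J_def by (auto simp: mult.commute)

text \<open>The resolvent identity: the difference of the inverses of \<open>P\<close> and
  \<open>Q\<close> is the inverse of \<open>P\<close> times \<open>Q - P\<close> times the inverse
  of \<open>Q\<close>. Each inverse contributes a factor \<open>2 / m\<close>.\<close>

lemma J_holder:
  assumes u: "u \<in> B" "c \<in> V" and v: "v \<in> B" "c' \<in> V"
  shows "norm (J u c k - J v c' k) \<le> (2 / m)^2 * norm k * C * (norm (u - v) + norm (c - c') powr \<alpha>)"
proof -
  have "J u c k - J v c' k = J u c ((D v c' - D u c) (J v c' k))"
    using J(1)[OF u] by (simp add: J[OF u] J[OF v] blinfun.diff_left linear_diff)
  also have "norm \<dots> \<le> 2 / m * norm ((D v c' - D u c) (J v c' k))"
    by (rule J(4)[OF u])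
  also have "\<dots> \<le> 2 / m * (norm (D v c' - D u c) * norm (J v c' k))"
    using pos by (intro mult_left_mono norm_blinfun) auto
  also have "\<dots> \<le> 2 / m * (C * (norm (u - v) + norm (c - c') powr \<alpha>) * (2 / m * norm k))"
    using D_holder[OF v u] J(4)[OF v] pos
    by (intro mult_left_mono mult_mono) (auto simp: norm_minus_commute)
  finally show ?thesis by (simp add: power2_eq_square mult_ac)
qed

lemma T_deriv:
  assumes c: "c \<in> V" "y \<in> (\<lambda>u. E u c) ` B"
  shows "(T c has_derivative J (T c y) c) (at y)"
proof (rule has_derivative_inverse_basic)
  note T = T_in[OF c(2)]
  show "((\<lambda>u. E u c) has_derivative D (T c y) c) (at (T c y))" by (rule E_deriv[OF T c(1)])
  show "bounded_linear (J (T c y) c)" using J(1)[OF T c(1)] by (simp add: linear_conv_bounded_linear)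
  show "J (T c y) c \<circ> D (T c y) c = id" by (auto simp: J(3)[OF T c(1)])
  have "(2 / m)-lipschitz_on ((\<lambda>u. E u c) ` B) (T c)"
    using T_holder[OF c(1) _ c(1)] pos by (intro lipschitz_onI) (auto simp: dist_norm)
  then have "continuous_on ((\<lambda>u. E u c) ` B) (T c)" by (rule lipschitz_on_continuous_on)
  then show "continuous (at y) (T c)"
    using E_open[OF c(1)] c(2) by (metis continuous_on_eq_continuous_at)
qed (use c E_open E_T in auto)

lemma T_diffeomorphism:
  assumes c: "c \<in> V" shows "diffeomorphism_onto_image B (\<lambda>u. E u c)"
  unfolding diffeomorphism_onto_image_def T_def[symmetric]
proof (intro conjI)
  let ?I = "(\<lambda>u. E u c) ` B"
  show "C1_on B (\<lambda>u. E u c)" unfolding C1_on_def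
  proof (intro conjI ballI allI)
    show "(\<lambda>u. E u c) differentiable at u" if "u \<in> B" for u
      using E_deriv[OF that c] by (auto simp: differentiable_def)
    fix j :: 'p
    have eq: "partial_deriv j (\<lambda>u. E u c) u = D u c (axis j 1)" if "u \<in> B" for u
      using frechet_derivative_at[OF E_deriv[OF that c]] by (simp add: partial_deriv_def)
    have "C-lipschitz_on B (partial_deriv j (\<lambda>u. E u c))"
    proof (rule lipschitz_onI)
      fix u v assume uv: "u \<in> B" "v \<in> B"
      have "norm ((D u c - D v c) (axis j 1)) \<le> C * norm (u - v)"
        using D_holder[OF uv(1) c uv(2) c] norm_blinfun[of "D u c - D v c" "axis j 1"] by simp
      then show "dist (partial_deriv j (\<lambda>u. E u c) u) (partial_deriv j (\<lambda>u. E u c) v) \<le> C * dist u v"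
        by (simp add: eq[OF uv(1)] eq[OF uv(2)] dist_norm blinfun.diff_left)
    qed (use pos in simp)
    then show "continuous_on B (partial_deriv j (\<lambda>u. E u c))" by (rule lipschitz_on_continuous_on)
  qed
  show "C1_on ?I (T c)" unfolding C1_on_def
  proof (intro conjI ballI allI)
    show "T c differentiable at y" if "y \<in> ?I" for y
      using T_deriv[OF c that] by (auto simp: differentiable_def)
    fix j :: 'p
    have eq: "partial_deriv j (T c) y = J (T c y) c (axis j 1)" if "y \<in> ?I" for y
      using frechet_derivative_at[OF T_deriv[OF c that]] by (simp add: partial_deriv_def)
    \<comment> \<open>For a fixed centre the Hoelder terms in \<open>c\<close> vanish, so the
      derivative of the inverse is Lipschitz: \<open>J\<close> is Lipschitz in \<open>u\<close>, and
      \<open>T\<close> is Lipschitz in \<open>y\<close>.\<close>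
    have "((2 / m)^2 * C * (2 / m))-lipschitz_on ?I (partial_deriv j (T c))"
    proof (rule lipschitz_onI)
      fix y z assume yz: "y \<in> ?I" "z \<in> ?I"
      have "dist (partial_deriv j (T c) y) (partial_deriv j (T c) z)
          \<le> (2 / m)^2 * C * norm (T c y - T c z)"
        using J_holder[OF T_in[OF yz(1)] c T_in[OF yz(2)] c, of "axis j 1"]
        by (simp add: eq yz dist_norm)
      also have "\<dots> \<le> (2 / m)^2 * C * (2 / m * norm (y - z))"
        using T_holder[OF c yz(1) c yz(2)] pos by (intro mult_left_mono) auto
      finally show "dist (partial_deriv j (T c) y) (partial_deriv j (T c) z)
          \<le> (2 / m)^2 * C * (2 / m) * dist y z"
        by (simp add: dist_norm mult_ac)
    qed (use pos in simp)
    then show "continuous_on ?I (partial_deriv j (T c))" by (rule lipschitz_on_continuous_on)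
  qed
qed (use c E_inj E_open in auto)

text \<open>The Brouwer fixed point theorem is applied to the Newton map
  \<open>u \<mapsto> u + A\<^sup>-\<^sup>1 (x - E u c)\<close> with \<open>A = D 0 x\<close>.\<close>

lemma x_in_image: assumes c: "c \<in> V" shows "x \<in> (\<lambda>u. E u c) ` B"
proof -
  let ?A = "blinfun_apply (D 0 x)"
  note A = linear_bounded_below_inv[OF bounded_linear.linear[OF blinfun.bounded_linear_right] below pos(3)]
  have sub: "cball 0 (\<rho> / 2) \<subseteq> B" using pos by auto
  have "\<exists>u\<in>cball 0 (\<rho> / 2). inv ?A (E u c) = inv ?A x"
  proof (rule brouwer_surjective_cball)
    have "continuous_on B (\<lambda>u. E u c)"
      using E_deriv[OF _ c] by (meson continuous_at_imp_continuous_on has_derivative_continuous)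
    then have "continuous_on (cball 0 (\<rho> / 2)) (\<lambda>u. E u c)" using sub by (rule continuous_on_subset)
    then show "continuous_on (cball 0 (\<rho> / 2)) (\<lambda>u. inv ?A (E u c))"
      using linear_continuous_on_compose[OF _ A(1)] by blast
    fix z u :: "real^'p" assume z: "z \<in> {inv ?A x}" and u: "u \<in> cball 0 (\<rho> / 2)"
    have uB: "u \<in> B" using u sub by blast
    \<comment> \<open>Inserting \<open>E 0 c = c\<close> separates the displacement
      \<open>x - c\<close> of the centre from the nonlinear part of the flow. After division by
      \<open>m\<close> each is at most \<open>\<rho> / 8\<close>, so the ball of radius
      \<open>\<rho> / 2\<close> is mapped into itself.\<close>
    have "z + (u - inv ?A (E u c)) = inv ?A ((x - c) - (E u c - E 0 c - ?A (u - 0)))"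
      using z by (simp add: linear_diff[OF A(1)] linear_add[OF A(1)] A(3) E_zero[OF c])
    also have "norm \<dots> \<le> norm ((x - c) - (E u c - E 0 c - ?A (u - 0))) / m" by (rule A(4))
    also have "\<dots> \<le> (\<delta> + m / 4 * norm (u - 0)) / m"
    proof (rule divide_right_mono, rule order_trans[OF norm_triangle_ineq4], rule add_mono)
      show "norm (x - c) \<le> \<delta>" using c by (simp add: dist_norm)
      show "norm (E u c - E 0 c - ?A (u - 0)) \<le> m / 4 * norm (u - 0)"
        by (rule E_near_linear) (use uB c pos in auto)
    qed (use pos in auto)
    also have "\<dots> \<le> (m * \<rho> / 8 + m / 4 * (\<rho> / 2)) / m"
      using u \<delta>_small pos by (intro divide_right_mono add_mono mult_left_mono) auto
    also have "\<dots> \<le> \<rho> / 2" using pos by (simp add: field_simps)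
    finally show "z + (u - inv ?A (E u c)) \<in> cball 0 (\<rho> / 2)" by simp
  qed (use pos in auto)
  then obtain u where "u \<in> B" "E u c = x" using sub A(2) by (metis subsetD)
  then show ?thesis by blast
qed

lemma inverse_holder: "holder_on \<alpha> V (\<lambda>c. T c x)"
  unfolding holder_on_def
  using T_holder[OF _ x_in_image _ x_in_image] by (intro exI[of _ "2 / m * C"]) (auto simp: dist_norm mult.assoc simp del: mem_ball)

text \<open>The derivative is \<open>J\<close> at the point \<open>T c x\<close>, which moves with
  the centre. Its displacement is Hoelder by \<open>T_holder\<close>, whence the factor
  \<open>2 / m * C + 1\<close>.\<close>

lemma inverse_deriv_holder: "holder_on \<alpha> V (\<lambda>c. frechet_derivative (T c) (at x) k)"
proof -
  have "norm (J (T c x) c k - J (T c' x) c' k)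
      \<le> (2 / m)^2 * norm k * C * (2 / m * C + 1) * norm (c - c') powr \<alpha>" if "c \<in> V" "c' \<in> V" for c c'
  proof -
    note x = x_in_image[OF that(1)] x_in_image[OF that(2)]
    have "norm (T c x - T c' x) \<le> 2 / m * C * norm (c - c') powr \<alpha>"
      using T_holder[OF that(1) x(1) that(2) x(2)] by simp
    then have "norm (T c x - T c' x) + norm (c - c') powr \<alpha> \<le> (2 / m * C + 1) * norm (c - c') powr \<alpha>"
      by (simp add: algebra_simps)
    then have "(2 / m)^2 * norm k * C * (norm (T c x - T c' x) + norm (c - c') powr \<alpha>)
        \<le> (2 / m)^2 * norm k * C * ((2 / m * C + 1) * norm (c - c') powr \<alpha>)"
      using pos by (intro mult_left_mono) auto
    then show ?thesis
      using J_holder[OF T_in[OF x(1)] that(1) T_in[OF x(2)] that(2), of k] by (simp add: mult.assoc)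
  qed
  moreover have "frechet_derivative (T c) (at x) = J (T c x) c" if "c \<in> V" for c
    using frechet_derivative_at[OF T_deriv[OF that x_in_image[OF that]]] by simp
  ultimately show ?thesis unfolding holder_on_def
    by (intro exI[of _ "(2 / m)^2 * norm k * C * (2 / m * C + 1)"]) (auto simp: dist_norm simp del: mem_ball)
qed

end

section \<open>Gradients\<close>

abbreviation has_gradient :: "(real^'p::finite \<Rightarrow> real) \<Rightarrow> ('p \<Rightarrow> real) \<Rightarrow> real^'p \<Rightarrow> bool" where
  "has_gradient f D x \<equiv> (f has_derivative (\<lambda>h. \<Sum>j\<in>UNIV. h $ j * D j)) (at x)"

lemma has_derivative_imp_gradient:
  fixes f :: "real^'p::finite \<Rightarrow> real"
  assumes "(f has_derivative D) (at x)"
  shows "has_gradient f (\<lambda>j. D (axis j 1)) x"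
proof -
  interpret D: bounded_linear D using assms by (rule has_derivative_bounded_linear)
  have eq: "D h = (\<Sum>j\<in>UNIV. h $ j * D (axis j 1))" for h
  proof -
    have "D (\<Sum>j\<in>UNIV. h $ j *\<^sub>R axis j 1) = (\<Sum>j\<in>UNIV. h $ j * D (axis j 1))"
      by (simp add: D.sum D.scaleR)
    then show ?thesis using basis_expansion[of h] by (simp add: scalar_mult_eq_scaleR)
  qed
  show ?thesis by (rule has_derivative_eq_rhs[OF assms]) (rule ext, rule eq)
qed

lemma has_gradient_partial_deriv:
  "has_gradient f D x \<Longrightarrow> partial_deriv j f x = D j"
  unfolding partial_deriv_def by (simp add: frechet_derivative_at[symmetric] axis_def if_distrib if_distribR sum.delta cong: if_cong)

lemma differentiable_imp_has_gradient:
  fixes f :: "real^'p::finite \<Rightarrow> real"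
  assumes "f differentiable (at x)" shows "has_gradient f (\<lambda>j. partial_deriv j f x) x"
  using has_derivative_imp_gradient[OF frechet_derivative_works[THEN iffD1, OF assms]]
  by (simp add: partial_deriv_def)

lemma has_gradient_const: "has_gradient (\<lambda>x. a) (\<lambda>j. 0) x"
  by simp

lemma has_gradient_coord: "has_gradient (\<lambda>x. x $ i) (\<lambda>j. if j = i then 1 else 0) x"
proof -
  have "((\<lambda>x. x $ i) has_derivative (\<lambda>h. h $ i)) (at x)"
    by (rule bounded_linear_imp_has_derivative) (rule bounded_linear_vec_nth)
  then show ?thesis by (simp add: if_distrib sum.delta cong: if_cong)
qed

lemma has_gradient_add:
  assumes "has_gradient f D x" "has_gradient g D' x"
  shows "has_gradient (\<lambda>x. f x + g x) (\<lambda>j. D j + D' j) x"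
  using has_derivative_add[OF assms] by (simp add: sum.distrib algebra_simps)

lemma has_gradient_mult:
  assumes "has_gradient f D x" "has_gradient g D' x"
  shows "has_gradient (\<lambda>x. f x * g x) (\<lambda>j. f x * D' j + g x * D j) x"
  using has_derivative_mult[OF assms]
  by (simp add: sum.distrib sum_distrib_left algebra_simps)

section \<open>Mixed partial derivatives\<close>

text \<open>The mean value theorem in direction \<open>i\<close>, applied to the difference of
  \<open>f\<close> across a step \<open>h\<close> in direction \<open>j\<close>, leaves a difference
  of two values of the partial derivative. Both are expanded at \<open>x\<close>, where
  differentiability suffices; the common linear part in direction \<open>i\<close> cancels.\<close>

lemma second_difference_quotient:
  fixes f :: "real^'p::finite \<Rightarrow> real"
  assumes S: "open S" "x \<in> S" and f: "\<And>y. y \<in> S \<Longrightarrow> f differentiable (at y)"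
    and g: "partial_deriv i f differentiable (at x)" and "0 < \<epsilon>"
  shows "\<exists>\<delta>>0. \<forall>h. 0 < h \<and> h < \<delta> \<longrightarrow>
    \<bar>f (x + h *\<^sub>R axis i 1 + h *\<^sub>R axis j 1) - f (x + h *\<^sub>R axis i 1) - f (x + h *\<^sub>R axis j 1) + f x
      - h^2 * partial_deriv j (partial_deriv i f) x\<bar> \<le> \<epsilon> * h^2"
proof -
  let ?g = "partial_deriv i f"
  define L where "L = frechet_derivative ?g (at x)"
  have L: "(?g has_derivative L) (at x)" unfolding L_def using g by (simp add: frechet_derivative_works)
  interpret L: bounded_linear L using L by (rule has_derivative_bounded_linear)
  obtain d1 where d1: "0 < d1" "\<And>y. norm (y - x) < d1 \<Longrightarrow>
      norm (?g y - ?g x - L (y - x)) \<le> \<epsilon> / 3 * norm (y - x)"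
    using L \<open>0 < \<epsilon>\<close> unfolding has_derivative_at_alt by (metis zero_less_divide_iff zero_less_numeral)
  obtain d2 where d2: "0 < d2" "ball x d2 \<subseteq> S" using S openE by blast
  \<comment> \<open>Half the radius, because the points used differ from \<open>x\<close> by two
    steps of length at most \<open>h\<close>.\<close>
  define \<delta> where "\<delta> = min d1 d2 / 2"
  have "\<bar>f (x + h *\<^sub>R axis i 1 + h *\<^sub>R axis j 1) - f (x + h *\<^sub>R axis i 1) - f (x + h *\<^sub>R axis j 1) + f x
      - h^2 * partial_deriv j ?g x\<bar> \<le> \<epsilon> * h^2" if h: "0 < h" "h < \<delta>" for h
  proof -
    let ?i = "axis i 1 :: real^'p" and ?j = "axis j 1 :: real^'p"
    have near: "norm (s *\<^sub>R ?i + r *\<^sub>R ?j) \<le> s + r" if "0 \<le> s" "0 \<le> r" for s r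
      using that by (intro norm_triangle_le) (simp add: norm_axis_1)
    have inS: "x + s *\<^sub>R ?i + r *\<^sub>R ?j \<in> S" if "0 \<le> s" "s \<le> h" "0 \<le> r" "r \<le> h" for s r
    proof -
      have "dist x (x + s *\<^sub>R ?i + r *\<^sub>R ?j) = norm (s *\<^sub>R ?i + r *\<^sub>R ?j)"
        using norm_minus_cancel[of "s *\<^sub>R ?i + r *\<^sub>R ?j"] by (simp add: dist_norm del: norm_minus_cancel)
      also have "\<dots> < d2" using near[of s r] that h by (simp add: \<delta>_def)
      finally show ?thesis using d2(2) by auto
    qed
    define u where "u s = f (x + s *\<^sub>R ?i + h *\<^sub>R ?j) - f (x + s *\<^sub>R ?i + 0 *\<^sub>R ?j)" for s
    define u' where "u' s = ?g (x + s *\<^sub>R ?i + h *\<^sub>R ?j) - ?g (x + s *\<^sub>R ?i + 0 *\<^sub>R ?j)" for s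
    have *: "((\<lambda>s. f (x + s *\<^sub>R ?i + r *\<^sub>R ?j)) has_field_derivative ?g (x + s *\<^sub>R ?i + r *\<^sub>R ?j)) (at s)"
      if "0 \<le> s" "s \<le> h" "0 \<le> r" "r \<le> h" for s r
    proof -
      let ?y = "x + s *\<^sub>R ?i + r *\<^sub>R ?j"
      have "(f has_derivative frechet_derivative f (at ?y)) (at ?y)"
        using f[OF inS[OF that]] by (simp add: frechet_derivative_works)
      moreover have "((\<lambda>s. x + s *\<^sub>R ?i + r *\<^sub>R ?j) has_derivative (\<lambda>t. t *\<^sub>R ?i)) (at s)"
        by (auto intro!: derivative_eq_intros)
      ultimately have der: "((\<lambda>s. f (x + s *\<^sub>R ?i + r *\<^sub>R ?j)) has_derivative
          (\<lambda>t. frechet_derivative f (at ?y) (t *\<^sub>R ?i))) (at s)"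
        by (rule has_derivative_compose[rotated])
      have eq: "(\<lambda>t. frechet_derivative f (at ?y) (t *\<^sub>R ?i)) = (*) (?g ?y)"
        by (rule ext) (simp add: partial_deriv_def linear_scale[OF linear_frechet_derivative[OF f[OF inS[OF that]]]])
      show ?thesis using der unfolding eq has_field_derivative_def .
    qed
    have "\<exists>z. 0 < z \<and> z < h \<and> u h - u 0 = (h - 0) * u' z"
      using h unfolding u_def u'_def by (intro MVT2 DERIV_diff *) auto
    then obtain s where s: "0 < s" "s < h" "u h - u 0 = h * u' s" by auto
    have err: "\<bar>?g (x + s *\<^sub>R ?i + r *\<^sub>R ?j) - ?g x - L (s *\<^sub>R ?i + r *\<^sub>R ?j)\<bar> \<le> \<epsilon> / 3 * (s + r)"
      if "0 \<le> r" "r \<le> h" for r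
    proof -
      have "norm (s *\<^sub>R ?i + r *\<^sub>R ?j) < d1"
        using near[of s r] s that h by (simp add: \<delta>_def)
      then have "\<bar>?g (x + s *\<^sub>R ?i + r *\<^sub>R ?j) - ?g x - L (s *\<^sub>R ?i + r *\<^sub>R ?j)\<bar>
          \<le> \<epsilon> / 3 * norm (s *\<^sub>R ?i + r *\<^sub>R ?j)"
        using d1(2)[of "x + (s *\<^sub>R ?i + r *\<^sub>R ?j)"] by (simp add: add.assoc)
      also have "\<dots> \<le> \<epsilon> / 3 * (s + r)" using near[of s r] s that \<open>0 < \<epsilon>\<close> by (intro mult_left_mono) auto
      finally show ?thesis .
    qed
    have "L (s *\<^sub>R ?i + h *\<^sub>R ?j) = L (s *\<^sub>R ?i + 0 *\<^sub>R ?j) + h * L ?j"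
      by (simp add: L.add L.scaleR)
    then have "\<bar>u' s - h * L ?j\<bar> \<le> \<epsilon> / 3 * (s + h) + \<epsilon> / 3 * (s + 0)"
      using err[of h] err[of 0] h unfolding u'_def by linarith
    \<comment> \<open>The two expansions are at distances at most \<open>2 * h\<close> and
      \<open>h\<close> from \<open>x\<close>, which explains the division of the error by 3.\<close>
    also have "\<dots> \<le> \<epsilon> / 3 * (h + h) + \<epsilon> / 3 * (h + 0)"
      using s \<open>0 < \<epsilon>\<close> by (intro add_mono mult_left_mono) auto
    finally have "h * \<bar>u' s - h * L ?j\<bar> \<le> h * (\<epsilon> * h)" using h by (intro mult_left_mono) auto
    moreover have "h * \<bar>u' s - h * L ?j\<bar> = \<bar>(u h - u 0) - h^2 * L ?j\<bar>"
    proof -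
      have "h * (u' s - h * L ?j) = (u h - u 0) - h^2 * L ?j"
        using s(3) by (simp add: algebra_simps power2_eq_square)
      then show ?thesis using h abs_mult[of h "u' s - h * L ?j"] by simp
    qed
    ultimately show ?thesis
      by (simp add: u_def partial_deriv_def[of j] L_def power2_eq_square algebra_simps)
  qed
  then show ?thesis using d1 d2 by (intro exI[of _ \<delta>]) (auto simp: \<delta>_def)
qed

text \<open>The second difference is symmetric in \<open>i\<close> and \<open>j\<close>, and divided
  by \<open>h^2\<close> it approximates either mixed derivative.\<close>

lemma partial_deriv_commute:
  fixes f :: "real^'p::finite \<Rightarrow> real"
  assumes S: "open S" "x \<in> S" and f: "\<And>y. y \<in> S \<Longrightarrow> f differentiable (at y)"
    and gi: "partial_deriv i f differentiable (at x)" and gj: "partial_deriv j f differentiable (at x)"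
  shows "partial_deriv j (partial_deriv i f) x = partial_deriv i (partial_deriv j f) x" (is "?a = ?b")
proof -
  have "\<bar>?a - ?b\<bar> \<le> 0 + e" if "0 < e" for e
  proof -
    let ?\<Delta> = "\<lambda>h. f (x + h *\<^sub>R axis i 1 + h *\<^sub>R axis j 1) - f (x + h *\<^sub>R axis i 1) - f (x + h *\<^sub>R axis j 1) + f x"
    have "0 < e/2" using that by simp
    obtain d1 where d1: "0 < d1" "\<And>h. 0 < h \<Longrightarrow> h < d1 \<Longrightarrow> \<bar>?\<Delta> h - h^2 * ?a\<bar> \<le> e/2 * h^2"
      using second_difference_quotient[OF S f gi \<open>0 < e/2\<close>, of j] by blast
    obtain d2 where d2: "0 < d2" "\<And>h. 0 < h \<Longrightarrow> h < d2 \<Longrightarrow>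
        \<bar>f (x + h *\<^sub>R axis j 1 + h *\<^sub>R axis i 1) - f (x + h *\<^sub>R axis j 1) - f (x + h *\<^sub>R axis i 1) + f x
          - h^2 * ?b\<bar> \<le> e/2 * h^2"
      using second_difference_quotient[OF S f gj \<open>0 < e/2\<close>, of i] by blast
    define h where "h = min d1 d2 / 2"
    have h: "0 < h" "h < d1" "h < d2" using d1 d2 by (auto simp: h_def)
    have "x + h *\<^sub>R axis j 1 + h *\<^sub>R axis i 1 = x + h *\<^sub>R axis i 1 + h *\<^sub>R axis j 1" by simp
    then have "\<bar>h^2 * ?a - h^2 * ?b\<bar> \<le> e * h^2"
      using d1(2)[OF h(1,2)] d2(2)[OF h(1,3)] by (simp only:)
    then have "h^2 * \<bar>?a - ?b\<bar> \<le> h^2 * e"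
      by (simp add: abs_mult mult.commute flip: right_diff_distrib)
    then show ?thesis using h by simp
  qed
  then have "\<bar>?a - ?b\<bar> \<le> 0" by (rule field_le_epsilon)
  then show ?thesis by simp
qed

section \<open>Taylor polynomials\<close>

definition times_differentiable :: "nat \<Rightarrow> (real^'p::finite) set \<Rightarrow> (real^'p \<Rightarrow> real) \<Rightarrow> bool" where
  "times_differentiable m S f \<longleftrightarrow>
     (\<forall>js. length js < m \<longrightarrow> (\<forall>x\<in>S. iter_partial js f differentiable (at x)))"

lemma iter_partial_snoc: "iter_partial (js @ [j]) f = iter_partial js (partial_deriv j f)"
  by (induction js) auto

lemma times_differentiable_partial:
  assumes "times_differentiable (Suc m) S f" shows "times_differentiable m S (partial_deriv j f)"
  unfolding times_differentiable_def
proof (intro allI impI)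
  fix js :: "'a list" assume "length js < m"
  then show "\<forall>x\<in>S. iter_partial js (partial_deriv j f) differentiable at x"
    using assms[unfolded times_differentiable_def, rule_format, of "js @ [j]"] by (simp add: iter_partial_snoc)
qed

lemma times_differentiable_D:
  "times_differentiable (Suc m) S f \<Longrightarrow> x \<in> S \<Longrightarrow> f differentiable (at x)"
  unfolding times_differentiable_def by (metis iter_partial.simps(1) length_0_conv zero_less_Suc)

lemma partial_deriv_cong:
  assumes "open S" "x \<in> S" and eq: "\<And>y. y \<in> S \<Longrightarrow> f y = g y"
  shows "partial_deriv j f x = partial_deriv j g x"
proof -
  have "(f has_derivative D) (at x) \<longleftrightarrow> (g has_derivative D) (at x)" for D
    using has_derivative_transform_within_open[OF _ assms(1,2), of f D UNIV g]
      has_derivative_transform_within_open[OF _ assms(1,2), of g D UNIV f] eq by auto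
  then show ?thesis unfolding partial_deriv_def frechet_derivative_def by simp
qed

lemma iter_partial_cong:
  assumes "open S" and eq: "\<And>y. y \<in> S \<Longrightarrow> f y = g y"
  shows "x \<in> S \<Longrightarrow> iter_partial js f x = iter_partial js g x"
proof (induction js arbitrary: x)
  case (Cons j js)
  show ?case using partial_deriv_cong[OF assms(1) Cons.prems Cons.IH] by simp
qed (use eq in auto)

text \<open>The \<open>k\<close>-th derivative of \<open>f\<close> at \<open>c\<close> as a
  homogeneous form, evaluated at \<open>k\<close> copies of \<open>v\<close>.\<close>

definition taylor_form :: "nat \<Rightarrow> (real^'p::finite \<Rightarrow> real) \<Rightarrow> real^'p \<Rightarrow> real^'p \<Rightarrow> real" where
  "taylor_form k f c v = (\<Sum>js | length js = k. iter_partial js f c * prod_list (map (\<lambda>j. v $ j) js))"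

lemma taylor_poly_eq: "taylor_poly m f c x = (\<Sum>k\<le>m. taylor_form k f c (x - c) / fact k)"
  by (simp add: taylor_poly_def taylor_form_def)

lemma taylor_form_0: "taylor_form 0 f c v = f c"
proof -
  have "{js :: 'a list. length js = 0} = {[]}" by auto
  then show ?thesis by (simp add: taylor_form_def)
qed

text \<open>The last entry of a tuple is the innermost derivative in \<open>iter_partial\<close>;
  splitting it off leaves a form of degree \<open>k\<close> of a first partial derivative of
  \<open>f\<close>.\<close>

lemma taylor_form_Suc:
  "taylor_form (Suc k) f c v = (\<Sum>j\<in>UNIV. v $ j * taylor_form k (partial_deriv j f) c v)"
proof -
  have "taylor_form (Suc k) f c v =
      (\<Sum>(j, js)\<in>UNIV \<times> {js. length js = k}. iter_partial (js @ [j]) f c * prod_list (map (\<lambda>j. v $ j) (js @ [j])))"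
    unfolding taylor_form_def
  proof (rule sum.reindex_bij_witness[where i="\<lambda>(j, js). js @ [j]" and j="\<lambda>js. (last js, butlast js)"])
    fix js :: "'a list" assume "js \<in> {js. length js = Suc k}"
    then obtain js' j where "js = js' @ [j]" by (metis append_butlast_last_id length_0_conv mem_Collect_eq nat.distinct(1))
    then show "(case (last js, butlast js) of (j, js) \<Rightarrow> js @ [j]) = js"
      and "(case (last js, butlast js) of (j, js) \<Rightarrow> iter_partial (js @ [j]) f c * prod_list (map (($) v) (js @ [j])))
        = iter_partial js f c * prod_list (map (($) v) js)" by simp_all
  qed auto
  also have "\<dots> = (\<Sum>j\<in>UNIV. \<Sum>js | length js = k.
      iter_partial (js @ [j]) f c * prod_list (map (\<lambda>j. v $ j) (js @ [j])))"
    by (simp add: sum.cartesian_product)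
  also have "\<dots> = (\<Sum>j\<in>UNIV. v $ j * taylor_form k (partial_deriv j f) c v)"
    by (simp add: taylor_form_def sum_distrib_left iter_partial_snoc mult_ac)
  finally show ?thesis .
qed

lemma taylor_form_cong:
  assumes "open S" "c \<in> S" "\<And>y. y \<in> S \<Longrightarrow> f y = g y"
  shows "taylor_form k f c v = taylor_form k g c v"
  unfolding taylor_form_def using iter_partial_cong[OF assms(1,3,2)] by simp

text \<open>Differentiating a symmetric form of degree \<open>k\<close> on the diagonal gives
  \<open>k\<close> equal terms. In the induction the symmetry is the exchange of two partial
  derivatives on \<open>S\<close>. For \<open>k = 0\<close> the truncated \<open>k - 1\<close> is
  harmless, being multiplied by 0.\<close>

lemma taylor_form_gradient:
  assumes S: "open S" "c \<in> S"
  shows "times_differentiable k S f \<Longrightarrow>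
    has_gradient (taylor_form k f c) (\<lambda>i. real k * taylor_form (k - 1) (partial_deriv i f) c v) v"
proof (induction k arbitrary: f)
  case 0
  then show ?case by (simp add: taylor_form_0[abs_def])
next
  case (Suc k)
  let ?t = "taylor_form"
  have "has_gradient (\<lambda>v. \<Sum>j\<in>UNIV. v $ j * ?t k (partial_deriv j f) c v)
      (\<lambda>i. \<Sum>j\<in>UNIV. v $ j * (real k * ?t (k - 1) (partial_deriv i (partial_deriv j f)) c v)
        + ?t k (partial_deriv j f) c v * (if i = j then 1 else 0)) v"
    (is "has_gradient ?f ?D v")
  proof -
    have "(?f has_derivative (\<lambda>h. \<Sum>j\<in>UNIV. \<Sum>i\<in>UNIV. h $ i *
        (v $ j * (real k * ?t (k - 1) (partial_deriv i (partial_deriv j f)) c v)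
        + ?t k (partial_deriv j f) c v * (if i = j then 1 else 0)))) (at v)"
      by (intro has_derivative_sum has_gradient_mult has_gradient_coord Suc.IH
          times_differentiable_partial[OF Suc.prems])
    then show ?thesis by (subst (asm) sum.swap) (simp only: sum_distrib_left)
  qed
  moreover have "?D i = real (Suc k) * ?t k (partial_deriv i f) c v" for i
  proof -
    have "(\<Sum>j\<in>UNIV. v $ j * (real k * ?t (k - 1) (partial_deriv i (partial_deriv j f)) c v))
        = real k * ?t k (partial_deriv i f) c v"
    proof (cases k)
      case (Suc l)
      have "partial_deriv i (partial_deriv j f) y = partial_deriv j (partial_deriv i f) y" if "y \<in> S" for j y
        using Suc.prems that unfolding Suc
        by (intro partial_deriv_commute[OF S(1) that])
          (auto intro: times_differentiable_D times_differentiable_partial)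
      then have "?t l (partial_deriv i (partial_deriv j f)) c v = ?t l (partial_deriv j (partial_deriv i f)) c v" for j
        by (rule taylor_form_cong[OF S])
      then show ?thesis by (simp add: Suc taylor_form_Suc sum_distrib_left mult_ac)
    qed simp
    moreover have "(\<Sum>j\<in>UNIV. ?t k (partial_deriv j f) c v * (if i = j then 1 else 0)) = ?t k (partial_deriv i f) c v"
      by (simp add: if_distrib sum.delta cong: if_cong)
    ultimately show ?thesis by (simp only: sum.distrib) (simp add: algebra_simps)
  qed
  ultimately show ?case by (simp add: taylor_form_Suc[abs_def])
qed

text \<open>Differentiation commutes with taking Taylor polynomials and lowers the order by one.
  This allows an induction on the order when jets are compared.\<close>

lemma taylor_poly_gradient:
  assumes S: "open S" "c \<in> S" and f: "times_differentiable (Suc m) S f"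
  shows "has_gradient (taylor_poly (Suc m) f c) (\<lambda>i. taylor_poly m (partial_deriv i f) c x) x"
proof -
  have f': "times_differentiable k S f" if "k \<le> Suc m" for k
    using f that unfolding times_differentiable_def by auto
  let ?g = "\<lambda>k i. real k * taylor_form (k - 1) (partial_deriv i f) c (x - c) / fact k"
  have "((\<lambda>x. taylor_form k f c (x - c) / fact k) has_derivative (\<lambda>h. \<Sum>i\<in>UNIV. h $ i * ?g k i)) (at x)"
    if "k \<le> Suc m" for k
  proof -
    have "((\<lambda>x. x - c) has_derivative (\<lambda>h. h)) (at x)" by (auto intro!: derivative_eq_intros)
    from has_derivative_compose[OF this taylor_form_gradient[OF S f'[OF that]]]
    have "((\<lambda>x. taylor_form k f c (x - c)) has_derivative
        (\<lambda>h. \<Sum>i\<in>UNIV. h $ i * (real k * taylor_form (k - 1) (partial_deriv i f) c (x - c)))) (at x)" .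
    from bounded_linear.has_derivative[OF bounded_linear_divide this, of "fact k"]
    show ?thesis by (simp add: sum_divide_distrib)
  qed
  then have "((\<lambda>x. \<Sum>k\<le>Suc m. taylor_form k f c (x - c) / fact k) has_derivative
      (\<lambda>h. \<Sum>k\<le>Suc m. \<Sum>i\<in>UNIV. h $ i * ?g k i)) (at x)"
    by (intro has_derivative_sum) auto
  moreover have "(\<Sum>k\<le>Suc m. \<Sum>i\<in>UNIV. h $ i * ?g k i) =
      (\<Sum>i\<in>UNIV. h $ i * taylor_poly m (partial_deriv i f) c x)" for h
  proof -
    \<comment> \<open>The factor \<open>real k\<close> kills the term of index 0; after a shift of
      the index it reduces the factorial by one step.\<close>
    have "(\<Sum>k\<le>Suc m. ?g k i) = taylor_poly m (partial_deriv i f) c x" for i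
      by (simp add: sum.atMost_Suc_shift taylor_poly_eq del: sum.atMost_Suc of_nat_Suc)
    then show ?thesis
      by (subst sum.swap) (simp only: sum_distrib_left[symmetric])
  qed
  ultimately show ?thesis by (simp only: taylor_poly_eq[abs_def])
qed

lemma taylor_poly_center: "taylor_poly m f c c = f c"
proof (cases m)
  case (Suc l)
  then show ?thesis
    by (simp add: taylor_poly_eq sum.atMost_Suc_shift taylor_form_0 taylor_form_Suc del: sum.atMost_Suc)
qed (simp add: taylor_poly_eq taylor_form_0)

section \<open>Equality of jets\<close>

text \<open>Agreement of all derivatives up to order \<open>m\<close> at \<open>c\<close>, together
  with \<open>m\<close>-fold differentiability of both functions on \<open>S\<close>. Carrying the
  gradients as witnesses lets the product rule supply new witnesses, so that no formula for higher
  derivatives of products is required.\<close>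

fun jet_eq :: "nat \<Rightarrow> (real^'p::finite) set \<Rightarrow> real^'p \<Rightarrow> (real^'p \<Rightarrow> real) \<Rightarrow> (real^'p \<Rightarrow> real) \<Rightarrow> bool" where
  "jet_eq 0 S c f g \<longleftrightarrow> f c = g c"
| "jet_eq (Suc m) S c f g \<longleftrightarrow> f c = g c \<and> (\<exists>f' g'.
     (\<forall>x\<in>S. has_gradient f (\<lambda>j. f' j x) x \<and> has_gradient g (\<lambda>j. g' j x) x) \<and>
     (\<forall>j. jet_eq m S c (f' j) (g' j)))"

lemma jet_eq_value: "jet_eq m S c f g \<Longrightarrow> f c = g c"
  by (cases m) auto

lemma jet_eq_SucD: "jet_eq (Suc m) S c f g \<Longrightarrow> jet_eq m S c f g"
proof (induction m arbitrary: f g)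
  case (Suc m)
  from Suc.prems obtain f' g' where "f c = g c"
    "\<forall>x\<in>S. has_gradient f (\<lambda>j. f' j x) x \<and> has_gradient g (\<lambda>j. g' j x) x"
    "\<forall>j. jet_eq (Suc m) S c (f' j) (g' j)"
    by (simp only: jet_eq.simps(2)[of "Suc m"]) blast
  then show ?case using Suc.IH by (simp only: jet_eq.simps(2)) blast
qed simp

lemma jet_eq_mono: "jet_eq m S c f g \<Longrightarrow> k \<le> m \<Longrightarrow> jet_eq k S c f g"
proof (induction m)
  case (Suc m)
  then show ?case by (cases "k = Suc m") (auto dest!: jet_eq_SucD simp del: jet_eq.simps)
qed (simp only: le_zero_eq)

lemma jet_eq_add:
  "jet_eq m S c f g \<Longrightarrow> jet_eq m S c f2 g2 \<Longrightarrow> jet_eq m S c (\<lambda>x. f x + f2 x) (\<lambda>x. g x + g2 x)"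
proof (induction m arbitrary: f g f2 g2)
  case (Suc m)
  from Suc.prems obtain f' g' f2' g2' where
    1: "f c = g c" "\<forall>x\<in>S. has_gradient f (\<lambda>j. f' j x) x \<and> has_gradient g (\<lambda>j. g' j x) x"
      "\<forall>j. jet_eq m S c (f' j) (g' j)" and
    2: "f2 c = g2 c" "\<forall>x\<in>S. has_gradient f2 (\<lambda>j. f2' j x) x \<and> has_gradient g2 (\<lambda>j. g2' j x) x"
      "\<forall>j. jet_eq m S c (f2' j) (g2' j)"
    by (simp only: jet_eq.simps(2)) blast
  show ?case unfolding jet_eq.simps(2)
    by (intro conjI exI[of _ "\<lambda>j x. f' j x + f2' j x"] exI[of _ "\<lambda>j x. g' j x + g2' j x"] ballI allI
        Suc.IH has_gradient_add) (use 1 2 in auto)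
qed simp

lemma jet_eq_mult:
  "jet_eq m S c f g \<Longrightarrow> jet_eq m S c f2 g2 \<Longrightarrow> jet_eq m S c (\<lambda>x. f x * f2 x) (\<lambda>x. g x * g2 x)"
proof (induction m arbitrary: f g f2 g2)
  case (Suc m)
  from Suc.prems obtain f' g' f2' g2' where
    1: "f c = g c" "\<forall>x\<in>S. has_gradient f (\<lambda>j. f' j x) x \<and> has_gradient g (\<lambda>j. g' j x) x"
      "\<forall>j. jet_eq m S c (f' j) (g' j)" and
    2: "f2 c = g2 c" "\<forall>x\<in>S. has_gradient f2 (\<lambda>j. f2' j x) x \<and> has_gradient g2 (\<lambda>j. g2' j x) x"
      "\<forall>j. jet_eq m S c (f2' j) (g2' j)"
    by (simp only: jet_eq.simps(2)) blast
  show ?case unfolding jet_eq.simps(2)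
    by (intro conjI exI[of _ "\<lambda>j x. f x * f2' j x + f2 x * f' j x"]
        exI[of _ "\<lambda>j x. g x * g2' j x + g2 x * g' j x"] ballI allI
        jet_eq_add Suc.IH has_gradient_mult jet_eq_SucD[OF Suc.prems(1)] jet_eq_SucD[OF Suc.prems(2)])
      (use 1 2 in auto)
qed simp

lemma jet_eq_const: "jet_eq m S c (\<lambda>x. a) (\<lambda>x. a)"
proof (induction m arbitrary: a)
  case (Suc m)
  show ?case unfolding jet_eq.simps(2)
    by (intro conjI exI[of _ "\<lambda>j x. 0"] ballI allI Suc.IH has_gradient_const) auto
qed simp

lemma jet_eq_diff:
  assumes "jet_eq m S c f g" "jet_eq m S c f2 g2"
  shows "jet_eq m S c (\<lambda>x. f x - f2 x) (\<lambda>x. g x - g2 x)"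
  using jet_eq_add[OF assms(1) jet_eq_mult[OF jet_eq_const[of m S c "-1"] assms(2)]] by simp

lemma jet_eq_sum:
  assumes "finite A" "\<And>i. i \<in> A \<Longrightarrow> jet_eq m S c (f i) (g i)"
  shows "jet_eq m S c (\<lambda>x. \<Sum>i\<in>A. f i x) (\<lambda>x. \<Sum>i\<in>A. g i x)"
  using assms by (induction A rule: finite_induct) (auto intro: jet_eq_add jet_eq_const)

lemma jet_eq_cong:
  assumes S: "open S" "c \<in> S" and eq: "\<And>x. x \<in> S \<Longrightarrow> f x = f2 x" "\<And>x. x \<in> S \<Longrightarrow> g x = g2 x"
    and j: "jet_eq m S c f g"
  shows "jet_eq m S c f2 g2"
proof (cases m)
  case 0
  then show ?thesis using j eq S by simp
next
  case (Suc k)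
  have "has_gradient f2 D x" if "has_gradient f D x" "x \<in> S" for D x
    using has_derivative_transform_within_open[OF that(1) S(1) that(2) eq(1)] by simp
  moreover have "has_gradient g2 D x" if "has_gradient g D x" "x \<in> S" for D x
    using has_derivative_transform_within_open[OF that(1) S(1) that(2) eq(2)] by simp
  moreover obtain f' g' where "f c = g c"
    "\<forall>x\<in>S. has_gradient f (\<lambda>j. f' j x) x \<and> has_gradient g (\<lambda>j. g' j x) x"
    "\<forall>j. jet_eq k S c (f' j) (g' j)"
    using j unfolding Suc jet_eq.simps(2) by blast
  ultimately show ?thesis using eq[OF S(2)] unfolding Suc jet_eq.simps(2)
    by (intro conjI exI[of _ f'] exI[of _ g']) auto
qed

lemma jet_eq_partial:
  assumes S: "open S" "c \<in> S" and j: "jet_eq (Suc m) S c f g"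
  shows "jet_eq m S c (partial_deriv j f) (partial_deriv j g)"
proof -
  from j obtain f' g' where
    1: "\<forall>x\<in>S. has_gradient f (\<lambda>j. f' j x) x \<and> has_gradient g (\<lambda>j. g' j x) x"
      "\<forall>j. jet_eq m S c (f' j) (g' j)"
    by (simp only: jet_eq.simps(2)) blast
  show ?thesis
    by (rule jet_eq_cong[OF S _ _ 1(2)[rule_format, of j]]; rule has_gradient_partial_deriv[symmetric])
      (use 1(1) in blast)+
qed

lemma jet_eq_differentiable:
  assumes "jet_eq (Suc m) S c f g" "x \<in> S"
  shows "f differentiable (at x)" "g differentiable (at x)"
  using assms by (auto simp: differentiable_def)

lemma jet_eq_taylor_poly:
  assumes S: "open S" "c \<in> S"
  shows "times_differentiable m S f \<Longrightarrow> jet_eq m S c f (taylor_poly m f c)"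
proof (induction m arbitrary: f)
  case (Suc m)
  show ?case unfolding jet_eq.simps(2)
    by (intro conjI exI[of _ "\<lambda>j x. partial_deriv j f x"] exI[of _ "\<lambda>j x. taylor_poly m (partial_deriv j f) c x"]
        ballI allI differentiable_imp_has_gradient taylor_poly_gradient[OF S Suc.prems]
        Suc.IH[OF times_differentiable_partial[OF Suc.prems]] times_differentiable_D[OF Suc.prems])
      (auto simp: taylor_poly_center)
qed (simp add: taylor_poly_center)

section \<open>Commutators of the approximating fields\<close>

lemma has_derivative_componentwise_vec:
  fixes f :: "'a::real_normed_vector \<Rightarrow> real^'p::finite"
  assumes "\<And>i. ((\<lambda>x. f x $ i) has_derivative (\<lambda>h. f' h $ i)) (at x)"
  shows "(f has_derivative f') (at x)"
  by (subst has_derivative_componentwise_within) (use assms in \<open>auto simp: Basis_vec_def inner_axis\<close>)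

lemma lie_bracket_component:
  assumes X: "\<And>j. (\<lambda>x. X x $ j) differentiable (at x)" and Y: "\<And>j. (\<lambda>x. Y x $ j) differentiable (at x)"
  shows "lie_bracket X Y x $ i =
    (\<Sum>l\<in>UNIV. X x $ l * partial_deriv l (\<lambda>y. Y y $ i) x - Y x $ l * partial_deriv l (\<lambda>y. X y $ i) x)"
proof -
  have *: "frechet_derivative Z (at x) h $ i = (\<Sum>l\<in>UNIV. h $ l * partial_deriv l (\<lambda>y. Z y $ i) x)"
    if Z: "\<And>j. (\<lambda>x. Z x $ j) differentiable (at x)" for Z :: "'a vfield" and h
  proof -
    have "(Z has_derivative (\<lambda>h. \<chi> j. \<Sum>l\<in>UNIV. h $ l * partial_deriv l (\<lambda>y. Z y $ j) x)) (at x)"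
      by (rule has_derivative_componentwise_vec) (simp add: differentiable_imp_has_gradient[OF Z])
    then show ?thesis by (simp add: frechet_derivative_at[symmetric])
  qed
  show ?thesis unfolding lie_bracket_def
    by (simp add: *[OF X] *[OF Y] sum_subtractf)
qed

text \<open>A bracket contains one derivative of each field, so one order is lost on each side, and
  the smaller remaining order survives.\<close>

lemma jet_eq_lie_bracket:
  assumes S: "open S" "c \<in> S"
    and X: "\<And>j. jet_eq (Suc a) S c (\<lambda>x. X x $ j) (\<lambda>x. X' x $ j)"
    and Y: "\<And>j. jet_eq (Suc b) S c (\<lambda>x. Y x $ j) (\<lambda>x. Y' x $ j)"
    and m: "m \<le> a" "m \<le> b"
  shows "jet_eq m S c (\<lambda>x. lie_bracket X Y x $ i) (\<lambda>x. lie_bracket X' Y' x $ i)"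
proof (rule jet_eq_cong[OF S])
  show "jet_eq m S c
    (\<lambda>x. \<Sum>l\<in>UNIV. X x $ l * partial_deriv l (\<lambda>y. Y y $ i) x - Y x $ l * partial_deriv l (\<lambda>y. X y $ i) x)
    (\<lambda>x. \<Sum>l\<in>UNIV. X' x $ l * partial_deriv l (\<lambda>y. Y' y $ i) x - Y' x $ l * partial_deriv l (\<lambda>y. X' y $ i) x)"
    using m by (intro jet_eq_sum jet_eq_diff jet_eq_mult finite
        jet_eq_mono[OF jet_eq_partial[OF S X]] jet_eq_mono[OF jet_eq_partial[OF S Y]]
        jet_eq_mono[OF X] jet_eq_mono[OF Y]) auto
qed (use jet_eq_differentiable[OF X] jet_eq_differentiable[OF Y] in \<open>auto simp: lie_bracket_component\<close>)

lemma field_weight_pos: "0 < field_weight i"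
  by (simp add: field_weight_def)

lemma weight_Cons: "weight (i # I) = field_weight i + weight I"
  by (simp add: weight_def)

lemma weight_pos: "I \<noteq> [] \<Longrightarrow> 0 < weight I"
  using field_weight_pos by (cases I) (auto simp: weight_Cons)

text \<open>The orders match because weights are positive: bracketing jets of orders
  \<open>r - field_weight i\<close> and \<open>r - weight J\<close> needs one derivative of each,
  and \<open>r - field_weight i - weight J\<close> is smaller than both by at least one.\<close>

lemma jet_eq_commutator:
  assumes S: "open S" "c \<in> S"
    and X: "\<And>i j. i \<le> n \<Longrightarrow> times_differentiable (r - field_weight i) S (\<lambda>x. X i x $ j)"
  shows "I \<noteq> [] \<Longrightarrow> set I \<subseteq> {0..n} \<Longrightarrow> weight I \<le> r \<Longrightarrow>
    jet_eq (r - weight I) S c (\<lambda>x. commutator X I x $ j) (\<lambda>x. commutator (approx_field r X c) I x $ j)"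
proof (induction I arbitrary: j rule: induct_list012)
  case (2 i)
  then show ?case
    using jet_eq_taylor_poly[OF S X[of i j]] by (simp add: approx_field_def weight_Cons weight_def[of "[]"])
next
  case (3 i i2 I)
  let ?J = "i2 # I"
  have w: "field_weight i + weight ?J \<le> r" using "3.prems" by (simp add: weight_Cons)
  have J: "0 < weight ?J" by (rule weight_pos) simp
  obtain a where a: "r - field_weight i = Suc a"
    using w J by (cases "r - field_weight i") auto
  obtain b where b: "r - weight ?J = Suc b"
    using w field_weight_pos[of i] by (cases "r - weight ?J") auto
  have 1: "jet_eq (r - field_weight i) S c (\<lambda>x. X i x $ j) (\<lambda>x. approx_field r X c i x $ j)" for j
    using jet_eq_taylor_poly[OF S X[of i j]] "3.prems" by (simp add: approx_field_def)
  have 2: "jet_eq (r - weight ?J) S c (\<lambda>x. commutator X ?J x $ j) (\<lambda>x. commutator (approx_field r X c) ?J x $ j)" for j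
    using "3.IH"(2)[of j] "3.prems" w by auto
  show ?case unfolding commutator.simps
    by (rule jet_eq_lie_bracket[OF S 1[unfolded a] 2[unfolded b]])
      (use a b J field_weight_pos[of i] in \<open>auto simp: weight_Cons\<close>)
qed simp

section \<open>Polynomials with Hoelder continuous coefficients\<close>

lemma le_powr_of_le_one:
  fixes d :: real assumes "0 \<le> d" "d \<le> 1" "0 < \<alpha>" "\<alpha> \<le> 1" shows "d \<le> d powr \<alpha>"
  using powr_mono'[of \<alpha> 1 d] assms by simp

lemma dist_in_ball_half:
  assumes "y \<in> ball x e" "z \<in> ball x e" "e \<le> 1/2" shows "dist y z \<le> 1"
  using dist_triangle[of y z x] assms by (simp add: dist_commute)

text \<open>Hoelder continuous partial derivatives are bounded near a point, so the function is
  Lipschitz there. In a ball of radius at most 1/2 distances are at most 1 and do not exceed their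
  power \<open>\<alpha>\<close>.\<close>

lemma locally_holder_on_of_partial_derivs:
  fixes f :: "real^'p::finite \<Rightarrow> real"
  assumes S: "open S" and \<alpha>: "0 < \<alpha>" "\<alpha> \<le> 1" and f: "\<And>x. x \<in> S \<Longrightarrow> f differentiable (at x)"
    and f': "\<And>j. locally_holder_on \<alpha> S (partial_deriv j f)"
  shows "locally_holder_on \<alpha> S f"
  unfolding locally_holder_on_def
proof
  fix x assume x: "x \<in> S"
  have "\<forall>j. \<exists>e C. e > 0 \<and> (\<forall>y\<in>S \<inter> ball x e. \<forall>z\<in>S \<inter> ball x e.
      dist (partial_deriv j f y) (partial_deriv j f z) \<le> C * dist y z powr \<alpha>)"
    using f' x unfolding locally_holder_on_def holder_on_def by blast
  then obtain e C where e: "\<And>j. e j > 0" and C: "\<And>j y z. y \<in> S \<inter> ball x (e j) \<Longrightarrow> z \<in> S \<inter> ball x (e j) \<Longrightarrow>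
      dist (partial_deriv j f y) (partial_deriv j f z) \<le> C j * dist y z powr \<alpha>"
    by metis
  obtain e0 where e0: "0 < e0" "ball x e0 \<subseteq> S" using S x openE by blast
  define \<epsilon> where "\<epsilon> = Min (insert e0 (insert (1/2) (range e)))"
  have \<epsilon>: "0 < \<epsilon>" unfolding \<epsilon>_def using e e0 by (subst Min_gr_iff) auto
  have \<epsilon>_le: "\<epsilon> \<le> e0" "\<epsilon> \<le> 1/2" "\<And>j. \<epsilon> \<le> e j" unfolding \<epsilon>_def by (rule Min_le; simp)+
  have sub: "ball x \<epsilon> \<subseteq> S" using e0 \<epsilon>_le by auto
  define b where "b j = \<bar>partial_deriv j f x\<bar> + \<bar>C j\<bar>" for j
  have b: "\<bar>partial_deriv j f y\<bar> \<le> b j" if y: "y \<in> ball x \<epsilon>" for j y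
  proof -
    have "dist (partial_deriv j f y) (partial_deriv j f x) \<le> C j * dist y x powr \<alpha>"
      using y x sub e[of j] \<epsilon>_le(3)[of j] by (intro C) auto
    also have "\<dots> \<le> \<bar>C j\<bar> * 1"
      using y \<epsilon>_le(2) \<alpha> by (intro mult_mono powr_le1) (auto simp: dist_commute)
    finally show ?thesis by (auto simp: b_def dist_real_def)
  qed
  have "dist (f y) (f z) \<le> (\<Sum>j\<in>UNIV. b j) * dist y z powr \<alpha>" if yz: "y \<in> ball x \<epsilon>" "z \<in> ball x \<epsilon>" for y z
  proof -
    have "norm (f y - f z) \<le> (\<Sum>j\<in>UNIV. b j) * norm (y - z)"
    proof (rule differentiable_bound)
      show "(f has_derivative (\<lambda>h. \<Sum>j\<in>UNIV. h $ j * partial_deriv j f w)) (at w within ball x \<epsilon>)"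
        if "w \<in> ball x \<epsilon>" for w
        using that sub by (intro has_derivative_at_withinI[OF differentiable_imp_has_gradient] f) auto
      show "onorm (\<lambda>h. \<Sum>j\<in>UNIV. h $ j * partial_deriv j f w) \<le> (\<Sum>j\<in>UNIV. b j)"
        if "w \<in> ball x \<epsilon>" for w
      proof (rule onorm_le)
        fix h :: "real^'p"
        have "norm (\<Sum>j\<in>UNIV. h $ j * partial_deriv j f w) \<le> (\<Sum>j\<in>UNIV. norm h * b j)"
          by (intro sum_norm_le) (auto simp: abs_mult intro!: mult_mono b that component_le_norm_cart)
        then show "norm (\<Sum>j\<in>UNIV. h $ j * partial_deriv j f w) \<le> (\<Sum>j\<in>UNIV. b j) * norm h"
          by (simp add: sum_distrib_left mult.commute)
      qed
    qed (use yz in auto)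
    also have "\<dots> \<le> (\<Sum>j\<in>UNIV. b j) * norm (y - z) powr \<alpha>"
      using dist_in_ball_half[OF yz \<epsilon>_le(2)] \<alpha>
      by (intro mult_left_mono le_powr_of_le_one sum_nonneg) (auto simp: dist_norm b_def)
    finally show ?thesis by (simp add: dist_norm)
  qed
  then show "\<exists>\<epsilon>>0. holder_on \<alpha> (S \<inter> ball x \<epsilon>) f"
    using \<epsilon> unfolding holder_on_def by blast
qed

text \<open>Descending induction on the number of derivatives, since \<open>C_holder_on\<close>
  states the Hoelder condition at the top order only.\<close>

lemma C_holder_on_iter_partial:
  fixes f :: "real^'p::finite \<Rightarrow> real"
  assumes S: "open S" and \<alpha>: "0 < \<alpha>" "\<alpha> \<le> 1" and f: "C_holder_on k \<alpha> S f"
  shows "length js \<le> k \<Longrightarrow> locally_holder_on \<alpha> S (iter_partial js f)"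
proof (induction "k - length js" arbitrary: js)
  case 0
  then show ?case using f by (simp add: C_holder_on_def)
next
  case (Suc d)
  have "length js < k" using Suc by simp
  show ?case
  proof (rule locally_holder_on_of_partial_derivs[OF S \<alpha>])
    show "iter_partial js f differentiable (at x)" if "x \<in> S" for x
      using f \<open>length js < k\<close> that by (simp add: C_holder_on_def)
    show "locally_holder_on \<alpha> S (partial_deriv j (iter_partial js f))" for j
      using Suc.hyps(1)[of "j # js"] Suc.hyps(2) \<open>length js < k\<close> by simp
  qed
qed

text \<open>The first argument is the center \<open>c\<close> of the Taylor expansion, the second one the space
  variable \<open>y\<close>.\<close>

inductive_set holder_poly :: "real \<Rightarrow> (real^'p::finite) set \<Rightarrow> (real^'p \<Rightarrow> real^'p \<Rightarrow> real) set"
  for \<alpha> S where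
  coeff: "locally_holder_on \<alpha> S a \<Longrightarrow> (\<lambda>c y. a c) \<in> holder_poly \<alpha> S"
| coord: "(\<lambda>c y. y $ j) \<in> holder_poly \<alpha> S"
| add: "f \<in> holder_poly \<alpha> S \<Longrightarrow> g \<in> holder_poly \<alpha> S \<Longrightarrow> (\<lambda>c y. f c y + g c y) \<in> holder_poly \<alpha> S"
| mult: "f \<in> holder_poly \<alpha> S \<Longrightarrow> g \<in> holder_poly \<alpha> S \<Longrightarrow> (\<lambda>c y. f c y * g c y) \<in> holder_poly \<alpha> S"

lemma holder_poly_const: "(\<lambda>c y. a) \<in> holder_poly \<alpha> S"
proof -
  have "locally_holder_on \<alpha> S (\<lambda>c. a)"
    unfolding locally_holder_on_def holder_on_def by (metis dist_self mult_zero_left order_refl zero_less_one)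
  then show ?thesis by (rule holder_poly.coeff)
qed

lemma holder_poly_diff:
  assumes "f \<in> holder_poly \<alpha> S" "g \<in> holder_poly \<alpha> S"
  shows "(\<lambda>c y. f c y - g c y) \<in> holder_poly \<alpha> S"
  using holder_poly.add[OF assms(1) holder_poly.mult[OF holder_poly_const[of "-1"] assms(2)]] by simp

lemma holder_poly_sum:
  "(\<And>i. i \<in> A \<Longrightarrow> f i \<in> holder_poly \<alpha> S) \<Longrightarrow> (\<lambda>c y. \<Sum>i\<in>A. f i c y) \<in> holder_poly \<alpha> S"
  by (induction A rule: infinite_finite_induct) (auto intro: holder_poly_const holder_poly.add)

text \<open>Taylor polynomials involve powers of \<open>y - c\<close>, so the coordinates of the
  centre must also be admissible as coefficients.\<close>

lemma holder_poly_center: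
  assumes \<alpha>: "0 < \<alpha>" "\<alpha> \<le> 1" shows "(\<lambda>c y. c $ j) \<in> holder_poly \<alpha> S"
proof -
  have "holder_on \<alpha> (S \<inter> ball x (1/2)) (\<lambda>c. c $ j)" for x :: "real^'a"
    unfolding holder_on_def
  proof (intro exI[of _ 1] ballI)
    fix y z :: "real^'a" assume yz: "y \<in> S \<inter> ball x (1/2)" "z \<in> S \<inter> ball x (1/2)"
    have "dist (y $ j) (z $ j) \<le> dist y z" by (rule dist_vec_nth_le)
    also have "\<dots> \<le> dist y z powr \<alpha>"
      using dist_in_ball_half[of y x "1/2" z] yz \<alpha> by (intro le_powr_of_le_one) auto
    finally show "dist (y $ j) (z $ j) \<le> 1 * dist y z powr \<alpha>" by simp
  qed
  then have "locally_holder_on \<alpha> S (\<lambda>c. c $ j)"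
    unfolding locally_holder_on_def by (intro ballI exI[of _ "1/2"]) auto
  then show ?thesis by (rule holder_poly.coeff)
qed

text \<open>Space derivatives treat the coefficients as constants and never differentiate them in
  \<open>c\<close>. The class is thus closed under differentiation, and therefore under Lie
  brackets.\<close>

lemma holder_poly_gradient:
  "f \<in> holder_poly \<alpha> S \<Longrightarrow>
    \<exists>f'. (\<forall>j. f' j \<in> holder_poly \<alpha> S) \<and> (\<forall>c y. has_gradient (f c) (\<lambda>j. f' j c y) y)"
proof (induction rule: holder_poly.induct)
  case (coeff a)
  show ?case
    by (intro exI[of _ "\<lambda>j c y. 0"] conjI allI holder_poly_const has_gradient_const)
next
  case (coord i)
  show ?case
    by (intro exI[of _ "\<lambda>j c y. if j = i then 1 else 0"] conjI allI holder_poly_const has_gradient_coord)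
next
  case (add f g)
  then obtain f' g' where
    "\<forall>j. f' j \<in> holder_poly \<alpha> S" "\<forall>c y. has_gradient (f c) (\<lambda>j. f' j c y) y"
    "\<forall>j. g' j \<in> holder_poly \<alpha> S" "\<forall>c y. has_gradient (g c) (\<lambda>j. g' j c y) y" by blast
  then show ?case
    by (intro exI[of _ "\<lambda>j c y. f' j c y + g' j c y"] conjI allI holder_poly.add has_gradient_add) auto
next
  case (mult f g)
  then obtain f' g' where
    "\<forall>j. f' j \<in> holder_poly \<alpha> S" "\<forall>c y. has_gradient (f c) (\<lambda>j. f' j c y) y"
    "\<forall>j. g' j \<in> holder_poly \<alpha> S" "\<forall>c y. has_gradient (g c) (\<lambda>j. g' j c y) y" by blast
  with mult.hyps show ?case
    by (intro exI[of _ "\<lambda>j c y. f c y * g' j c y + g c y * f' j c y"] conjI allI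
        holder_poly.add holder_poly.mult has_gradient_mult) auto
qed

lemma holder_poly_differentiable: "f \<in> holder_poly \<alpha> S \<Longrightarrow> f c differentiable (at y)"
  using holder_poly_gradient[of f \<alpha> S] by (auto simp: differentiable_def)

lemma holder_poly_partial_deriv:
  assumes "f \<in> holder_poly \<alpha> S" shows "(\<lambda>c. partial_deriv j (f c)) \<in> holder_poly \<alpha> S"
proof -
  obtain f' where f': "\<forall>j. f' j \<in> holder_poly \<alpha> S" "\<And>c y. has_gradient (f c) (\<lambda>j. f' j c y) y"
    using holder_poly_gradient[OF assms] by blast
  have "(\<lambda>c. partial_deriv j (f c)) = f' j"
    by (intro ext) (rule has_gradient_partial_deriv[OF f'(2)])
  then show ?thesis using f'(1) by simp
qed

lemma holder_poly_taylor_poly: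
  assumes \<alpha>: "0 < \<alpha>" "\<alpha> \<le> 1" and f: "\<And>js. length js \<le> m \<Longrightarrow> locally_holder_on \<alpha> S (iter_partial js f)"
  shows "(\<lambda>c. taylor_poly m f c) \<in> holder_poly \<alpha> S"
proof -
  have "(\<lambda>c y. prod_list (map (\<lambda>j. (y - c) $ j) js)) \<in> holder_poly \<alpha> S" for js
    by (induction js) (auto intro!: holder_poly_const holder_poly.mult holder_poly_diff
        holder_poly.coord holder_poly_center \<alpha>)
  then have "(\<lambda>c y. \<Sum>k\<le>m. (\<Sum>js | length js = k. iter_partial js f c *
      prod_list (map (\<lambda>j. (y - c) $ j) js)) * (1 / fact k)) \<in> holder_poly \<alpha> S"
    by (intro holder_poly_sum holder_poly.mult holder_poly_const holder_poly.coeff f) auto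
  then show ?thesis by (simp only: taylor_poly_def[abs_def] times_divide_eq_right mult_1_right)
qed

lemma holder_poly_lie_bracket:
  assumes Y: "\<And>j. (\<lambda>c y. Y c y $ j) \<in> holder_poly \<alpha> S" and Z: "\<And>j. (\<lambda>c y. Z c y $ j) \<in> holder_poly \<alpha> S"
  shows "(\<lambda>c y. lie_bracket (Y c) (Z c) y $ j) \<in> holder_poly \<alpha> S"
proof -
  have "(\<lambda>c y. lie_bracket (Y c) (Z c) y $ j) =
    (\<lambda>c y. \<Sum>l\<in>UNIV. Y c y $ l * partial_deriv l (\<lambda>y. Z c y $ j) y - Z c y $ l * partial_deriv l (\<lambda>y. Y c y $ j) y)"
    by (intro ext lie_bracket_component holder_poly_differentiable[OF Y] holder_poly_differentiable[OF Z])
  also have "\<dots> \<in> holder_poly \<alpha> S"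
    by (intro holder_poly_sum holder_poly_diff holder_poly.mult holder_poly_partial_deriv[OF Y]
        holder_poly_partial_deriv[OF Z] Y Z)
  finally show ?thesis .
qed

lemma holder_poly_commutator:
  assumes "\<And>i j. i \<le> n \<Longrightarrow> (\<lambda>c y. Y c i y $ j) \<in> holder_poly \<alpha> S"
  shows "set I \<subseteq> {0..n} \<Longrightarrow> (\<lambda>c y. commutator (Y c) I y $ j) \<in> holder_poly \<alpha> S"
proof (induction I arbitrary: j rule: induct_list012)
  case (3 i i2 I)
  show ?case unfolding commutator.simps
    by (rule holder_poly_lie_bracket) (use assms 3 in auto)
qed (use assms holder_poly_const in auto)

text \<open>The form of the bounds required in \<open>holder_family\<close>, for scalar functions.
  Using the same constant for the size and for the modulus makes products easy to estimate.\<close>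

definition holder_estimate :: "real \<Rightarrow> real^'p::finite \<Rightarrow> real \<Rightarrow> real \<Rightarrow> (real^'p \<Rightarrow> real^'p \<Rightarrow> real) \<Rightarrow> bool" where
  "holder_estimate \<alpha> x \<epsilon> M f \<longleftrightarrow>
    (\<forall>c\<in>cball x \<epsilon>. \<forall>y\<in>cball x \<epsilon>. \<bar>f c y\<bar> \<le> M \<and> (\<forall>c'\<in>cball x \<epsilon>. \<forall>y'\<in>cball x \<epsilon>.
      \<bar>f c y - f c' y'\<bar> \<le> M * (norm (y - y') + norm (c - c') powr \<alpha>)))"

lemma holder_estimate_mono:
  assumes "holder_estimate \<alpha> x \<epsilon> M f" "\<epsilon>' \<le> \<epsilon>" "M \<le> M'" shows "holder_estimate \<alpha> x \<epsilon>' M' f"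
  unfolding holder_estimate_def
proof (intro ballI conjI)
  fix c y c' y' assume "c \<in> cball x \<epsilon>'" "y \<in> cball x \<epsilon>'"
  then have cy: "c \<in> cball x \<epsilon>" "y \<in> cball x \<epsilon>" using assms(2) by auto
  then have "\<bar>f c y\<bar> \<le> M" using assms(1) unfolding holder_estimate_def by blast
  then show "\<bar>f c y\<bar> \<le> M'" using assms(3) by simp
  assume "c' \<in> cball x \<epsilon>'" "y' \<in> cball x \<epsilon>'"
  then have "c' \<in> cball x \<epsilon>" "y' \<in> cball x \<epsilon>" using assms(2) by auto
  then have "\<bar>f c y - f c' y'\<bar> \<le> M * (norm (y - y') + norm (c - c') powr \<alpha>)"
    using assms(1) cy unfolding holder_estimate_def by blast
  also have "\<dots> \<le> M' * (norm (y - y') + norm (c - c') powr \<alpha>)"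
    using assms(3) by (intro mult_right_mono) auto
  finally show "\<bar>f c y - f c' y'\<bar> \<le> M' * (norm (y - y') + norm (c - c') powr \<alpha>)" .
qed

lemma holder_estimate_add:
  assumes "holder_estimate \<alpha> x \<epsilon> M f" "holder_estimate \<alpha> x \<epsilon> M g"
  shows "holder_estimate \<alpha> x \<epsilon> (2 * M) (\<lambda>c y. f c y + g c y)"
  unfolding holder_estimate_def
proof (intro ballI conjI)
  fix c y c' y' assume *: "c \<in> cball x \<epsilon>" "y \<in> cball x \<epsilon>"
  show "\<bar>f c y + g c y\<bar> \<le> 2 * M"
    using assms * unfolding holder_estimate_def by (smt (verit))
  assume "c' \<in> cball x \<epsilon>" "y' \<in> cball x \<epsilon>"
  then have "\<bar>f c y - f c' y'\<bar> \<le> M * (norm (y - y') + norm (c - c') powr \<alpha>)"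
    "\<bar>g c y - g c' y'\<bar> \<le> M * (norm (y - y') + norm (c - c') powr \<alpha>)"
    using assms * unfolding holder_estimate_def by blast+
  then show "\<bar>f c y + g c y - (f c' y' + g c' y')\<bar> \<le> 2 * M * (norm (y - y') + norm (c - c') powr \<alpha>)"
    by linarith
qed

lemma holder_estimate_mult:
  assumes "holder_estimate \<alpha> x \<epsilon> M f" "holder_estimate \<alpha> x \<epsilon> M g" and M: "0 \<le> M"
  shows "holder_estimate \<alpha> x \<epsilon> (2 * M^2) (\<lambda>c y. f c y * g c y)"
  unfolding holder_estimate_def
proof (intro ballI conjI)
  fix c y c' y' assume *: "c \<in> cball x \<epsilon>" "y \<in> cball x \<epsilon>"
  have b: "\<bar>f c y\<bar> \<le> M" "\<bar>g c y\<bar> \<le> M" using assms * unfolding holder_estimate_def by blast+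
  then have "\<bar>f c y * g c y\<bar> \<le> M * M" unfolding abs_mult by (intro mult_mono M) auto
  also have "\<dots> \<le> 2 * M^2" using M by (simp add: power2_eq_square)
  finally show "\<bar>f c y * g c y\<bar> \<le> 2 * M^2" .
  assume *: "c' \<in> cball x \<epsilon>" "y' \<in> cball x \<epsilon>"
  let ?\<Delta> = "norm (y - y') + norm (c - c') powr \<alpha>"
  have h: "\<bar>f c y - f c' y'\<bar> \<le> M * ?\<Delta>" "\<bar>g c y - g c' y'\<bar> \<le> M * ?\<Delta>" "\<bar>g c' y'\<bar> \<le> M"
    using assms * \<open>c \<in> _\<close> \<open>y \<in> _\<close> unfolding holder_estimate_def by blast+
  have "f c y * g c y - f c' y' * g c' y' = f c y * (g c y - g c' y') + g c' y' * (f c y - f c' y')"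
    by (simp add: algebra_simps)
  also have "\<bar>\<dots>\<bar> \<le> \<bar>f c y\<bar> * \<bar>g c y - g c' y'\<bar> + \<bar>g c' y'\<bar> * \<bar>f c y - f c' y'\<bar>"
    by (metis abs_mult abs_triangle_ineq)
  also have "\<dots> \<le> M * (M * ?\<Delta>) + M * (M * ?\<Delta>)"
    using b h M by (intro add_mono mult_mono) auto
  finally show "\<bar>f c y * g c y - f c' y' * g c' y'\<bar> \<le> 2 * M^2 * ?\<Delta>"
    by (simp add: power2_eq_square mult.assoc)
qed

lemma holder_estimate_common:
  assumes "finite A" "\<And>f. f \<in> A \<Longrightarrow> \<exists>\<epsilon>>0. \<exists>M\<ge>0. holder_estimate \<alpha> x \<epsilon> M f"
  shows "\<exists>\<epsilon>>0. \<exists>M\<ge>0. \<forall>f\<in>A. holder_estimate \<alpha> x \<epsilon> M f"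
  using assms
proof (induction A rule: finite_induct)
  case empty
  show ?case using zero_less_one by blast
next
  case (insert f A)
  obtain e1 M1 where 1: "0 < e1" "0 \<le> M1" "\<And>f. f \<in> A \<Longrightarrow> holder_estimate \<alpha> x e1 M1 f"
    using insert by auto
  obtain e2 M2 where 2: "0 < e2" "0 \<le> M2" "holder_estimate \<alpha> x e2 M2 f"
    using insert.prems[of f] by auto
  have "\<forall>g\<in>insert f A. holder_estimate \<alpha> x (min e1 e2) (max M1 M2) g"
    by (auto intro: holder_estimate_mono[OF 1(3)] holder_estimate_mono[OF 2(3)])
  moreover have "0 < min e1 e2" "0 \<le> max M1 M2" using 1 2 by auto
  ultimately show ?case by blast
qed

lemma holder_poly_estimate:
  assumes S: "open S" "x \<in> S" and \<alpha>: "0 < \<alpha>" "\<alpha> \<le> 1"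
  shows "f \<in> holder_poly \<alpha> S \<Longrightarrow> \<exists>\<epsilon>>0. \<exists>M\<ge>0. holder_estimate \<alpha> x \<epsilon> M f"
proof (induction rule: holder_poly.induct)
  case (coeff a)
  then obtain e C where e: "0 < e" and C: "\<And>y z. y \<in> S \<inter> ball x e \<Longrightarrow> z \<in> S \<inter> ball x e \<Longrightarrow>
      dist (a y) (a z) \<le> C * dist y z powr \<alpha>"
    using S(2) unfolding locally_holder_on_def holder_on_def by blast
  obtain e0 where e0: "0 < e0" "ball x e0 \<subseteq> S" using S openE by blast
  \<comment> \<open>Halving places the closed ball inside the open ones; radius at most 1 makes
    \<open>norm (c - x) powr \<alpha>\<close> at most 1.\<close>
  define \<epsilon> where "\<epsilon> = min 1 (min e e0) / 2"
  have \<epsilon>: "0 < \<epsilon>" "\<epsilon> \<le> 1" "cball x \<epsilon> \<subseteq> S \<inter> ball x e" using e e0 by (auto simp: \<epsilon>_def)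
  have h: "\<bar>a c - a c'\<bar> \<le> \<bar>C\<bar> * norm (c - c') powr \<alpha>" if "c \<in> cball x \<epsilon>" "c' \<in> cball x \<epsilon>" for c c'
  proof -
    have "\<bar>a c - a c'\<bar> \<le> C * norm (c - c') powr \<alpha>"
      using C[of c c'] subsetD[OF \<epsilon>(3) that(1)] subsetD[OF \<epsilon>(3) that(2)] by (simp add: dist_norm)
    also have "\<dots> \<le> \<bar>C\<bar> * norm (c - c') powr \<alpha>" by (intro mult_right_mono) auto
    finally show ?thesis .
  qed
  have "holder_estimate \<alpha> x \<epsilon> (\<bar>a x\<bar> + \<bar>C\<bar>) (\<lambda>c y. a c)" unfolding holder_estimate_def
  proof (intro ballI conjI)
    fix c c' y y' assume c: "c \<in> cball x \<epsilon>"
    have "\<bar>a c - a x\<bar> \<le> \<bar>C\<bar> * norm (c - x) powr \<alpha>" using \<epsilon> by (intro h c) auto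
    also have "\<dots> \<le> \<bar>C\<bar> * 1"
      using c \<epsilon>(2) \<alpha> by (intro mult_left_mono powr_le1) (auto simp: dist_norm norm_minus_commute)
    finally show "\<bar>a c\<bar> \<le> \<bar>a x\<bar> + \<bar>C\<bar>" by linarith
    assume "c' \<in> cball x \<epsilon>"
    then have "\<bar>a c - a c'\<bar> \<le> \<bar>C\<bar> * norm (c - c') powr \<alpha>" by (rule h[OF c])
    also have "\<dots> \<le> (\<bar>a x\<bar> + \<bar>C\<bar>) * (norm (y - y') + norm (c - c') powr \<alpha>)"
      by (intro mult_mono) auto
    finally show "\<bar>a c - a c'\<bar> \<le> (\<bar>a x\<bar> + \<bar>C\<bar>) * (norm (y - y') + norm (c - c') powr \<alpha>)" .
  qed
  moreover have "0 \<le> \<bar>a x\<bar> + \<bar>C\<bar>" by simp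
  ultimately show ?case using \<epsilon>(1) by blast
next
  case (coord j)
  have "holder_estimate \<alpha> x 1 (norm x + 1) (\<lambda>c y. y $ j)" unfolding holder_estimate_def
  proof (intro ballI conjI)
    fix c c' y y' :: "real^'a" assume "y \<in> cball x 1"
    then have "norm y \<le> norm x + 1"
      using norm_triangle_ineq2[of y x] by (simp add: dist_norm norm_minus_commute)
    then show "\<bar>y $ j\<bar> \<le> norm x + 1" using component_le_norm_cart order_trans by blast
    have "\<bar>y $ j - y' $ j\<bar> \<le> 1 * norm (y - y')"
      using component_le_norm_cart[of "y - y'" j] by simp
    also have "\<dots> \<le> (norm x + 1) * (norm (y - y') + norm (c - c') powr \<alpha>)" by (intro mult_mono) auto
    finally show "\<bar>y $ j - y' $ j\<bar> \<le> (norm x + 1) * (norm (y - y') + norm (c - c') powr \<alpha>)" .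
  qed
  moreover have "0 \<le> norm x + 1" by (simp add: add_nonneg_nonneg)
  ultimately show ?case using zero_less_one by blast
next
  case (add f g)
  then obtain \<epsilon> M where "0 < \<epsilon>" "0 \<le> M" "\<forall>h\<in>{f, g}. holder_estimate \<alpha> x \<epsilon> M h"
    using holder_estimate_common[of "{f, g}" \<alpha> x] by auto
  then have "holder_estimate \<alpha> x \<epsilon> (2 * M) (\<lambda>c y. f c y + g c y)" "0 \<le> 2 * M"
    by (auto intro: holder_estimate_add)
  then show ?case using \<open>0 < \<epsilon>\<close> by blast
next
  case (mult f g)
  then obtain \<epsilon> M where "0 < \<epsilon>" "0 \<le> M" "\<forall>h\<in>{f, g}. holder_estimate \<alpha> x \<epsilon> M h"
    using holder_estimate_common[of "{f, g}" \<alpha> x] by auto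
  then have "holder_estimate \<alpha> x \<epsilon> (2 * M^2) (\<lambda>c y. f c y * g c y)" "0 \<le> 2 * M^2"
    by (auto intro: holder_estimate_mult)
  then show ?case using \<open>0 < \<epsilon>\<close> by blast
qed

section \<open>The family of approximating fields\<close>

definition vec_blinfun :: "('p::finite \<Rightarrow> 'b::real_normed_vector) \<Rightarrow> (real^'p) \<Rightarrow>\<^sub>L 'b" where
  "vec_blinfun v = Blinfun (\<lambda>h. \<Sum>k\<in>UNIV. h $ k *\<^sub>R v k)"

lemma vec_blinfun_apply: "blinfun_apply (vec_blinfun v) h = (\<Sum>k\<in>UNIV. h $ k *\<^sub>R v k)"
proof -
  have "bounded_linear (\<lambda>h. \<Sum>k\<in>UNIV. h $ k *\<^sub>R v k)"
    by (intro bounded_linear_sum bounded_linear_scaleR_const bounded_linear_vec_nth)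
  then show ?thesis by (simp add: vec_blinfun_def bounded_linear_Blinfun_apply)
qed

lemma vec_blinfun_diff: "vec_blinfun v - vec_blinfun w = vec_blinfun (\<lambda>k. v k - w k)"
  by (rule blinfun_eqI) (simp add: blinfun.diff_left vec_blinfun_apply sum_subtractf scaleR_diff_right)

lemma norm_vec_blinfun_le:
  fixes v :: "'p::finite \<Rightarrow> 'b::real_normed_vector"
  assumes "\<And>k. norm (v k) \<le> b" shows "norm (vec_blinfun v) \<le> real CARD('p) * b"
proof (rule norm_blinfun_bound)
  have "0 \<le> b" using assms norm_ge_zero order_trans by blast
  then show "0 \<le> real CARD('p) * b" by simp
  fix h :: "real^'p"
  have "norm (\<Sum>k\<in>UNIV. h $ k *\<^sub>R v k) \<le> (\<Sum>k\<in>(UNIV :: 'p set). norm h * b)"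
    by (intro sum_norm_le) (auto intro!: mult_mono assms component_le_norm_cart)
  then show "norm (vec_blinfun v h) \<le> real CARD('p) * b * norm h"
    by (simp add: vec_blinfun_apply mult_ac)
qed

lemma norm_vec_le_CARD:
  fixes v :: "real^'p::finite"
  assumes "\<And>i. \<bar>v $ i\<bar> \<le> b" shows "norm v \<le> real CARD('p) * b"
proof -
  have "norm v \<le> (\<Sum>i\<in>UNIV. \<bar>v $ i\<bar>)" by (rule norm_le_l1_cart)
  also have "\<dots> \<le> (\<Sum>i\<in>(UNIV :: 'p set). b)" by (intro sum_mono assms)
  finally show ?thesis by simp
qed

lemma inj_vec_combination:
  fixes v :: "'p::finite \<Rightarrow> real^'q::finite"
  assumes inj: "inj v" and ind: "independent (range v)"
    and zero: "(\<Sum>k\<in>UNIV. h $ k *\<^sub>R v k) = 0"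
  shows "h = 0"
proof -
  have "(\<Sum>w\<in>range v. h $ (inv v w) *\<^sub>R w) = 0"
    using zero by (simp add: sum.reindex[OF inj] inv_f_f[OF inj])
  then have "h $ (inv v (v k)) = 0" for k
    using independentD[OF ind _ subset_refl, of "\<lambda>w. h $ (inv v w)" "v k"] by simp
  then show ?thesis by (simp add: vec_eq_iff inv_f_f[OF inj])
qed

text \<open>Only finitely many components \<open>P\<close> and partial derivatives \<open>Q\<close>
  occur, so they share one radius and one constant. Nesting \<open>vec_blinfun\<close> twice gives
  \<open>G\<close>: the outer argument is \<open>u\<close>, the inner one the space
  direction.\<close>

lemma holder_poly_field_family:
  fixes Z :: "real^'p::finite \<Rightarrow> 'p \<Rightarrow> 'p vfield"
  assumes S: "open S" "x \<in> S" and \<alpha>: "0 < \<alpha>" "\<alpha> \<le> 1"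
    and Z: "\<And>k j. (\<lambda>c y. Z c k y $ j) \<in> holder_poly \<alpha> S"
  shows "\<exists>G R M. holder_family (\<lambda>c y. vec_blinfun (\<lambda>k. Z c k y)) G x R M \<alpha>"
proof -
  define P where "P k i = (\<lambda>c y. Z c k y $ i)" for k i
  define Q where "Q k i l = (\<lambda>c. partial_deriv l (P k i c))" for k i l
  have PQ: "P k i \<in> holder_poly \<alpha> S" "Q k i l \<in> holder_poly \<alpha> S" for k i l
    unfolding Q_def using Z by (auto simp: P_def intro: holder_poly_partial_deriv)
  let ?A = "range (\<lambda>(k, i). P k i) \<union> range (\<lambda>(k, i, l). Q k i l)"
  have "\<exists>\<epsilon>>0. \<exists>M\<ge>0. \<forall>f\<in>?A. holder_estimate \<alpha> x \<epsilon> M f"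
    using PQ by (intro holder_estimate_common holder_poly_estimate[OF S \<alpha>]) auto
  then obtain \<epsilon> M0 where \<epsilon>: "0 < \<epsilon>" "0 \<le> M0" and est: "\<And>f. f \<in> ?A \<Longrightarrow> holder_estimate \<alpha> x \<epsilon> M0 f"
    by blast
  define R where "R = min \<epsilon> 1"
  have estP: "holder_estimate \<alpha> x R M0 (P k i)" for k i
    by (rule holder_estimate_mono[OF est[OF UnI1[OF range_eqI[of _ _ "(k, i)"]]]]) (auto simp: R_def)
  have estQ: "holder_estimate \<alpha> x R M0 (Q k i l)" for k i l
    by (rule holder_estimate_mono[OF est[OF UnI2[OF range_eqI[of _ _ "(k, i, l)"]]]]) (auto simp: R_def)
  define dZ where "dZ c k l y = (\<chi> i. Q k i l c y)" for c k l y
  let ?F = "\<lambda>c y. vec_blinfun (\<lambda>k. Z c k y)"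
  let ?G = "\<lambda>c y. vec_blinfun (\<lambda>k. vec_blinfun (\<lambda>l. dZ c k l y))"
  let ?p = "real CARD('p)"
  \<comment> \<open>Each sum over coordinates costs a factor \<open>?p\<close>: two for
    \<open>F\<close>, over the fields and their components, and a third for \<open>G\<close>, over
    the directions of differentiation.\<close>
  define M where "M = max 1 (?p * (?p * (?p * M0)))"
  have p: "1 \<le> ?p" using zero_less_card_finite[where 'a='p] by linarith
  have "1 * (?p * (?p * M0)) \<le> ?p * (?p * (?p * M0))" using p \<epsilon>(2) by (intro mult_right_mono) auto
  then have "?p * (?p * M0) \<le> ?p * (?p * (?p * M0))" by (simp only: mult_1)
  then have M: "1 \<le> M" "?p * (?p * M0) \<le> M" "?p * (?p * (?p * M0)) \<le> M"
    unfolding M_def by (simp_all only: max.cobounded1 max.cobounded2 max.coboundedI2)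
  have "holder_family ?F ?G x R M \<alpha>"
  proof
    show "0 < R" "R \<le> 1" "1 \<le> M" "0 < \<alpha>" "\<alpha> \<le> 1" using \<epsilon> M \<alpha> by (auto simp: R_def)
  next
    fix c y u
    have Z': "(Z c k has_derivative (\<lambda>h. \<Sum>l\<in>UNIV. h $ l *\<^sub>R dZ c k l y)) (at y)" for k
    proof (rule has_derivative_componentwise_vec)
      fix i
      have "(P k i c has_derivative (\<lambda>h. \<Sum>l\<in>UNIV. h $ l * Q k i l c y)) (at y)"
        unfolding Q_def by (intro differentiable_imp_has_gradient holder_poly_differentiable[OF PQ(1)])
      then show "((\<lambda>x. Z c k x $ i) has_derivative (\<lambda>h. (\<Sum>l\<in>UNIV. h $ l *\<^sub>R dZ c k l y) $ i)) (at y)"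
        by (simp add: P_def dZ_def)
    qed
    have G_apply: "blinfun_apply (?G c y u) = (\<lambda>h. \<Sum>k\<in>UNIV. u $ k *\<^sub>R (\<Sum>l\<in>UNIV. h $ l *\<^sub>R dZ c k l y))"
      by (rule ext) (simp add: vec_blinfun_apply blinfun.sum_left blinfun.scaleR_left)
    have "((\<lambda>y. \<Sum>k\<in>UNIV. u $ k *\<^sub>R Z c k y) has_derivative
        (\<lambda>h. \<Sum>k\<in>UNIV. u $ k *\<^sub>R (\<Sum>l\<in>UNIV. h $ l *\<^sub>R dZ c k l y))) (at y)"
      by (intro has_derivative_sum has_derivative_scaleR_right Z')
    then show "((\<lambda>y. ?F c y u) has_derivative (?G c y u)) (at y)"
      unfolding G_apply by (simp only: vec_blinfun_apply)
  next
    fix c y assume cy: "c \<in> cball x R" "y \<in> cball x R"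
    have P: "\<bar>P k i c y\<bar> \<le> M0" and Q: "\<bar>Q k i l c y\<bar> \<le> M0" for k i l
      using estP[of k i] estQ[of k i l] cy unfolding holder_estimate_def by blast+
    show "norm (?F c y) \<le> M"
      by (rule order_trans[OF norm_vec_blinfun_le M(2)], rule norm_vec_le_CARD) (use P in \<open>simp add: P_def\<close>)
    show "norm (?G c y) \<le> M"
      by (rule order_trans[OF norm_vec_blinfun_le M(3)], rule norm_vec_blinfun_le, rule norm_vec_le_CARD)
        (use Q in \<open>simp add: dZ_def\<close>)
    fix c' y' assume cy': "c' \<in> cball x R" "y' \<in> cball x R"
    let ?\<Delta> = "norm (y - y') + norm (c - c') powr \<alpha>"
    have P: "\<bar>P k i c y - P k i c' y'\<bar> \<le> M0 * ?\<Delta>" and Q: "\<bar>Q k i l c y - Q k i l c' y'\<bar> \<le> M0 * ?\<Delta>" for k i l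
      using estP[of k i] estQ[of k i l] cy cy' unfolding holder_estimate_def by blast+
    have "norm (?F c y - ?F c' y') \<le> ?p * (?p * (M0 * ?\<Delta>))"
      unfolding vec_blinfun_diff
      by (rule norm_vec_blinfun_le, rule norm_vec_le_CARD) (use P in \<open>simp add: P_def\<close>)
    also have "\<dots> = (?p * (?p * M0)) * ?\<Delta>" by simp
    also have "\<dots> \<le> M * ?\<Delta>" using M by (intro mult_right_mono) auto
    finally show "norm (?F c y - ?F c' y') \<le> M * ?\<Delta>" .
    have "norm (?G c y - ?G c' y') \<le> ?p * (?p * (?p * (M0 * ?\<Delta>)))"
      unfolding vec_blinfun_diff
      by (rule norm_vec_blinfun_le, rule norm_vec_blinfun_le, rule norm_vec_le_CARD) (use Q in \<open>simp add: dZ_def\<close>)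
    also have "\<dots> = (?p * (?p * (?p * M0))) * ?\<Delta>" by simp
    also have "\<dots> \<le> M * ?\<Delta>" using M by (intro mult_right_mono) auto
    finally show "norm (?G c y - ?G c' y') \<le> M * ?\<Delta>" .
  qed
  then show ?thesis by blast
qed

lemma holder_imp_locally_holder: "holder_on \<alpha> S f \<Longrightarrow> locally_holder_on \<alpha> S f"
  unfolding locally_holder_on_def holder_on_def
  by (metis IntD1 zero_less_one)

text \<open>The inverse depends on the ball on which it is taken, so the assertion is made for every
  sufficiently small radius \<open>\<rho>\<close>, with \<open>\<delta>\<close> depending on it.
  That \<open>x\<close> lies in the image is part of the conclusion, because \<open>inv_into\<close>
  is arbitrary outside the image.\<close>

theorem proposition31:
  fixes X :: "nat \<Rightarrow> 'p::finite vfield"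
    and \<Omega> :: "(real^'p) set"
    and n r :: nat
    and \<alpha> :: real
    and B :: "'p \<Rightarrow> nat list"
  assumes "open \<Omega>" and "connected \<Omega>" and "bounded \<Omega>"
    and "r \<ge> 2" and "0 < \<alpha>" and "\<alpha> \<le> 1"
    and "\<forall>i\<in>{1..n}. \<forall>j. C_holder_on (r - 1) \<alpha> \<Omega> (\<lambda>x. X i x $ j)"
    and "\<forall>j. C_holder_on (r - 2) \<alpha> \<Omega> (\<lambda>x. X 0 x $ j)"
    and "hormander_condition n r X \<Omega>"
    and "free_up_to_weight n r X \<Omega>"
    and "commutator_basis n r X \<Omega> B"
  shows "\<forall>x\<in>\<Omega>. \<exists>\<rho>0>0. \<forall>\<rho>. 0 < \<rho> \<and> \<rho> \<le> \<rho>0 \<longrightarrow> (\<exists>\<delta>>0. ball x \<delta> \<subseteq> \<Omega> \<and>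
           (\<forall>xbar\<in>ball x \<delta>. canonical_coordinates_on r X B \<rho> xbar \<and>
                            x \<in> (\<lambda>u. canonical_E r X B u xbar) ` ball 0 \<rho>) \<and>
           locally_holder_on \<alpha> (ball x \<delta>) (\<lambda>xbar. Theta r X B \<rho> xbar x) \<and>
           (\<forall>k j. locally_holder_on \<alpha> (ball x \<delta>)
                    (\<lambda>xbar. jacobian (Theta r X B \<rho> xbar) (at x) $ k $ j)))"
proof
  fix x assume x: "x \<in> \<Omega>"
  note S = \<open>open \<Omega>\<close> x and \<alpha> = \<open>0 < \<alpha>\<close> \<open>\<alpha> \<le> 1\<close>
  have X: "C_holder_on (r - field_weight i) \<alpha> \<Omega> (\<lambda>x. X i x $ j)" if "i \<le> n" for i j
    using assms(7,8) that by (cases "i = 0") (auto simp: field_weight_def)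
  have B: "B k \<noteq> []" "set (B k) \<subseteq> {0..n}" "weight (B k) \<le> r" for k
    using assms(11) unfolding commutator_basis_def multiindices_def by auto
  have Z: "(\<lambda>c y. commutator (approx_field r X c) (B k) y $ j) \<in> holder_poly \<alpha> \<Omega>" for k j
  proof (rule holder_poly_commutator[OF _ B(2)])
    show "(\<lambda>c y. approx_field r X c i y $ j) \<in> holder_poly \<alpha> \<Omega>" if "i \<le> n" for i j
      using holder_poly_taylor_poly[OF \<alpha> C_holder_on_iter_partial[OF S(1) \<alpha> X[OF that]]]
      by (simp add: approx_field_def)
  qed
  define F where "F c y = vec_blinfun (\<lambda>k. commutator (approx_field r X c) (B k) y)" for c y
  have "\<exists>G R M. holder_family F G x R M \<alpha>"
    unfolding F_def[abs_def]
    by (rule holder_poly_field_family[OF S \<alpha>, where Z="\<lambda>c k. commutator (approx_field r X c) (B k)", OF Z])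
  then obtain G R M where "holder_family F G x R M \<alpha>" by blast
  then interpret holder_family F G x R M \<alpha> .
  obtain D C where C: "0 \<le> C"
    and curves: "\<And>u c. u \<in> U \<Longrightarrow> c \<in> N \<Longrightarrow> \<exists>\<phi>. integral_curve (\<lambda>y. F c y u) c \<phi>"
    and E0: "\<And>c. c \<in> N \<Longrightarrow> E 0 c = c" and D0: "\<And>c. c \<in> N \<Longrightarrow> D 0 c = F c c"
    and E_h: "\<And>u c v c'. u \<in> U \<Longrightarrow> c \<in> N \<Longrightarrow> v \<in> U \<Longrightarrow> c' \<in> N \<Longrightarrow>
      norm (E u c - E v c') \<le> C * (norm (u - v) + norm (c - c') powr \<alpha>)"
    and D_h: "\<And>u c v c'. u \<in> U \<Longrightarrow> c \<in> N \<Longrightarrow> v \<in> U \<Longrightarrow> c' \<in> N \<Longrightarrow>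
      norm (D u c - D v c') \<le> C * (norm (u - v) + norm (c - c') powr \<alpha>)"
    and E_l: "\<And>u v c. u \<in> U \<Longrightarrow> v \<in> U \<Longrightarrow> c \<in> N \<Longrightarrow>
      norm (E v c - E u c - blinfun_apply (D u c) (v - u)) \<le> C * (norm (v - u))^2"
    by (rule flow_parameter_estimates) (rule that; assumption)
  have field: "canonical_field r X B u c = (\<lambda>y. F c y u)" for u c
    by (rule ext) (simp add: canonical_field_def F_def vec_blinfun_apply)
  have E_eq: "canonical_E r X B u c = E u c" for u c
    by (simp add: canonical_E_def E_def field)
  have xN: "x \<in> N" using R by (simp add: N_def)
  have jets: "commutator (approx_field r X x) (B k) x = commutator X (B k) x" for k
  proof (subst vec_eq_iff, rule allI)
    fix j
    have "times_differentiable (r - field_weight i) \<Omega> (\<lambda>x. X i x $ j)" if "i \<le> n" for i j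
      using X[OF that] by (simp add: C_holder_on_def times_differentiable_def)
    then show "commutator (approx_field r X x) (B k) x $ j = commutator X (B k) x $ j"
      using jet_eq_value[OF jet_eq_commutator[OF S _ B]] by metis
  qed
  \<comment> \<open>\<open>D 0 x\<close> is the frame of commutators of the approximating fields at
    \<open>x\<close>, which by \<open>jets\<close> are the original ones. Their independence gives
    injectivity, and in finite dimension a positive lower bound.\<close>
  obtain m where m: "0 < m" "\<And>h. m * norm h \<le> norm (D 0 x h)"
  proof (rule linear_inj_bounded_below_pos)
    show lin: "linear (D 0 x)" by (rule bounded_linear.linear[OF blinfun.bounded_linear_right])
    show "inj (D 0 x)"
    proof (rule linear_injective_0[OF lin, THEN iffD2], intro allI impI)
      fix h assume "D 0 x h = 0"
      then have zero: "(\<Sum>k\<in>UNIV. h $ k *\<^sub>R commutator X (B k) x) = 0"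
        by (simp add: D0[OF xN] F_def vec_blinfun_apply jets)
      have ind: "inj (\<lambda>k. commutator X (B k) x)" "independent (range (\<lambda>k. commutator X (B k) x))"
        using assms(11) x unfolding commutator_basis_def by blast+
      show "h = 0" by (rule inj_vec_combination[OF ind zero])
    qed
  qed blast
  \<comment> \<open>The first bound puts the ball into \<open>U\<close>; the second makes
    \<open>C * norm u\<close> at most \<open>m / 8\<close>, with \<open>C + 1\<close> as denominator
    since \<open>C\<close> may be 0.\<close>
  define \<rho>0 where "\<rho>0 = min (R / (4 * M)) (m / 8 / (C + 1))"
  have \<rho>0: "0 < \<rho>0" using R M m(1) C by (simp add: \<rho>0_def)
  show "\<exists>\<rho>0>0. \<forall>\<rho>. 0 < \<rho> \<and> \<rho> \<le> \<rho>0 \<longrightarrow> (\<exists>\<delta>>0. ball x \<delta> \<subseteq> \<Omega> \<and>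
           (\<forall>xbar\<in>ball x \<delta>. canonical_coordinates_on r X B \<rho> xbar \<and>
                            x \<in> (\<lambda>u. canonical_E r X B u xbar) ` ball 0 \<rho>) \<and>
           locally_holder_on \<alpha> (ball x \<delta>) (\<lambda>xbar. Theta r X B \<rho> xbar x) \<and>
           (\<forall>k j. locally_holder_on \<alpha> (ball x \<delta>)
                    (\<lambda>xbar. jacobian (Theta r X B \<rho> xbar) (at x) $ k $ j)))"
  proof (rule exI[of _ \<rho>0], intro conjI \<rho>0 allI impI, elim conjE)
    fix \<rho> :: real assume \<rho>: "0 < \<rho>" "\<rho> \<le> \<rho>0"
    obtain e where e: "0 < e" "ball x e \<subseteq> \<Omega>" using S openE by blast
    define q where "q = m / 8 / (C + 1)"
    have q: "0 < q" "C * q \<le> m / 8"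
    proof -
      show "0 < q" using m(1) C by (simp add: q_def)
      then have "C * q \<le> (C + 1) * q" by (intro mult_right_mono) auto
      moreover have "C + 1 \<noteq> 0" using C by linarith
      then have "(C + 1) * q = m / 8" unfolding q_def by (metis nonzero_mult_div_cancel_left times_divide_eq_right)
      ultimately show "C * q \<le> m / 8" by simp
    qed
    \<comment> \<open>In order: the ball of centres lies in the domain; it lies in \<open>N\<close>;
      \<open>C * norm (c - x) powr \<alpha>\<close> is at most \<open>m / 8\<close>, which with the
      same share for \<open>u\<close> yields the \<open>m / 4\<close> of \<open>D_near\<close>; and
      \<open>x\<close> is reached.\<close>
    define \<delta> where "\<delta> = min (min e (R / 2)) (min (q powr (1 / \<alpha>)) (m * \<rho> / 8))"
    have \<delta>: "0 < \<delta>" "\<delta> \<le> e" "\<delta> \<le> R / 2" "\<delta> \<le> q powr (1 / \<alpha>)" "\<delta> \<le> m * \<rho> / 8"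
      using e R q \<rho> m(1) by (auto simp: \<delta>_def)
    have uU: "u \<in> U" if "u \<in> ball 0 \<rho>" for u
    proof -
      have "norm u \<le> R / (4 * M)" using that \<rho> by (simp add: \<rho>0_def)
      then show ?thesis using M by (simp add: U_def field_simps)
    qed
    have cN: "c \<in> N" if "c \<in> ball x \<delta>" for c
      using that \<delta>(3) by (simp add: N_def)
    interpret near_linear_family E D x \<rho> \<delta> C m \<alpha>
    proof
      show "norm (D u c - D 0 x) \<le> m / 4" if u: "u \<in> ball 0 \<rho>" and c: "c \<in> ball x \<delta>" for u c
      proof -
        have "norm (c - x) powr \<alpha> \<le> (q powr (1 / \<alpha>)) powr \<alpha>"
          using c \<delta>(4) \<alpha> by (intro powr_mono2) (auto simp: dist_norm norm_minus_commute)
        also have "\<dots> = q" using q(1) \<alpha> by (simp add: powr_powr)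
        finally have "norm (c - x) powr \<alpha> \<le> q" .
        moreover have "norm u \<le> q" using u \<rho> by (simp add: \<rho>0_def q_def)
        ultimately have "C * (norm (u - 0) + norm (c - x) powr \<alpha>) \<le> C * (q + q)"
          using C by (intro mult_left_mono add_mono) auto
        moreover have "C * (q + q) \<le> m / 4" using q(2) by (simp add: algebra_simps)
        ultimately show ?thesis
          using D_h[OF uU[OF u] cN[OF c] zero_in_U xN] by linarith
      qed
    qed (use \<rho> \<delta> m C in \<open>auto intro!: E0 E_h D_h E_l uU cN simp del: mem_ball\<close>)
    have T_eq: "Theta r X B \<rho> c = T c" for c
      by (simp add: Theta_def T_def E_eq)
    show "\<exists>\<delta>>0. ball x \<delta> \<subseteq> \<Omega> \<and>
           (\<forall>xbar\<in>ball x \<delta>. canonical_coordinates_on r X B \<rho> xbar \<and>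
                            x \<in> (\<lambda>u. canonical_E r X B u xbar) ` ball 0 \<rho>) \<and>
           locally_holder_on \<alpha> (ball x \<delta>) (\<lambda>xbar. Theta r X B \<rho> xbar x) \<and>
           (\<forall>k j. locally_holder_on \<alpha> (ball x \<delta>)
                    (\<lambda>xbar. jacobian (Theta r X B \<rho> xbar) (at x) $ k $ j))"
    proof (rule exI[of _ \<delta>], intro conjI ballI allI \<delta>(1))
      show "ball x \<delta> \<subseteq> \<Omega>" using e(2) \<delta>(2) by (meson order_trans subset_ball)
      show "x \<in> (\<lambda>u. canonical_E r X B u c) ` ball 0 \<rho>" if "c \<in> ball x \<delta>" for c
        using x_in_image[OF that] by (simp add: E_eq)
      show "canonical_coordinates_on r X B \<rho> c" if "c \<in> ball x \<delta>" for c
        unfolding canonical_coordinates_on_def field E_eq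
        using T_diffeomorphism[OF that] curves[OF uU cN[OF that]] by blast
      show "locally_holder_on \<alpha> (ball x \<delta>) (\<lambda>c. Theta r X B \<rho> c x)"
        unfolding T_eq by (rule holder_imp_locally_holder) (rule inverse_holder)
      show "locally_holder_on \<alpha> (ball x \<delta>) (\<lambda>c. jacobian (Theta r X B \<rho> c) (at x) $ k $ j)" for k j
      proof (rule holder_imp_locally_holder)
        \<comment> \<open>Column \<open>j\<close> of the Jacobian matrix is the derivative applied
          to the \<open>j\<close>-th unit vector, and a component of a vector is 1-Lipschitz, so the
          constant of the column serves for each entry.\<close>
        obtain L where L: "\<And>c c'. c \<in> ball x \<delta> \<Longrightarrow> c' \<in> ball x \<delta> \<Longrightarrow>
            dist (frechet_derivative (T c) (at x) (axis j 1)) (frechet_derivative (T c') (at x) (axis j 1))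
              \<le> L * dist c c' powr \<alpha>"
          using inverse_deriv_holder[of "axis j 1"] unfolding holder_on_def by blast
        show "holder_on \<alpha> (ball x \<delta>) (\<lambda>c. jacobian (Theta r X B \<rho> c) (at x) $ k $ j)"
          unfolding holder_on_def jacobian_def matrix_def T_eq
          by (intro exI[of _ L] ballI) (simp add: order_trans[OF dist_vec_nth_le L] del: mem_ball)
      qed
    qed
  qed
qed

end
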